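(* For any integers $d,k\geq 1$ and any $\alpha\in(0,k/(k+1))$, the function $n^{-1/d}$ is a $G^d(n,r)$-perturbed threshold for the property of containing the $k$-th power of a Hamilton cycle. That is: (1) for every sequence of $n$-vertex graphs $H_n$ with $\delta(H_n)\geq\alpha n$, if $r=\omega(n^{-1/d})$ then $\lim_{n\to\infty}\mathbb{P}[H_n\cup G^d(n,r)\text{ contains the }k\text{-th power of a Hamilton cycle}]=1$; and (2) there exists a sequence of $n$-vertex graphs $H_n$ with $\delta(H_n)\geq\alpha n$ such that, if $r=o(n^{-1/d})$, then $\lim_{n\to\infty}\mathbb{P}[H_n\cup G^d(n,r)\text{ contains the }k\text{-th power of a Hamilton cycle}]=0$.
   Context: Random geometric graph: for $V=[n]=\{1,\dots,n\}$, let $X_1,\dots,X_n$ be independent uniform random points in $[0,1]^d$; $G^d(n,r)$ is the graph on $[n]$ with edge set $\{\{i,j\}:\|X_i-X_j\|_2\leq r\}$. For an $n$-vertex graph $H_n$ with vertex set $[n]$, $H_n\cup G^d(n,r)$ is the graph on $[n]$ whose edge set is $E(H_n)\cup\{\{i,j\}:\|X_i-X_j\|_2\leq r\}$. $\delta(H)$ denotes minimum degree. The $k$-th power of a graph $G$ is obtained from $G$ by adding an edge between any two vertices at distance at most $k$ in $G$; a Hamilton cycle is a cycle through all vertices. For a monotone graph property $P$, a function $r^*(n)$ is a $G^d(n,r)$-perturbed threshold for $P$ (with respect to $\alpha$) if (i) for every $H_n$ with $\delta(H_n)\ge\alpha n$, $\lim_{n\to\infty}\mathbb{P}[H_n\cup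 G^d(n,r)\in P]=1$ whenever $r=\omega(r^* )$, and (ii) there exists some $H_n$ with $\delta(H_n)\ge\alpha n$ such that $\lim_{n\to\infty}\mathbb{P}[H_n\cup G^d(n,r)\in P]=0$ whenever $r=o(r^* )$. *)

theory Defs
  imports "HOL-Probability.Probability" "HOL-Library.Landau_Symbols"
begin

text \<open>A graph is given by a vertex set \<open>V\<close> and a set \<open>E\<close> of two-element subsets of \<open>V\<close>.\<close>

definition simple_graph :: "'a set \<Rightarrow> 'a set set \<Rightarrow> bool" where
  "simple_graph V E \<longleftrightarrow> (\<forall>e\<in>E. e \<subseteq> V \<and> card e = 2)"

definition vert_degree :: "'a set set \<Rightarrow> 'a \<Rightarrow> nat" where
  "vert_degree E v = card {e \<in> E. v \<in> e}"

definition min_degree :: "'a set \<Rightarrow> 'a set set \<Rightarrow> nat" where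
  "min_degree V E = Min (vert_degree E ` V)"

definition is_walk :: "'a set set \<Rightarrow> 'a list \<Rightarrow> bool" where
  "is_walk E xs \<longleftrightarrow> xs \<noteq> [] \<and> (\<forall>i. Suc i < length xs \<longrightarrow> {xs ! i, xs ! Suc i} \<in> E)"

text \<open>The length of a walk is its number of edges; the distance is \<open>\<infinity>\<close> if there is no walk.\<close>

definition graph_dist :: "'a set set \<Rightarrow> 'a \<Rightarrow> 'a \<Rightarrow> enat" where
  "graph_dist E u v =
     Inf {enat (length xs - 1) | xs. is_walk E xs \<and> hd xs = u \<and> last xs = v}"

definition graph_power :: "nat \<Rightarrow> 'a set \<Rightarrow> 'a set set \<Rightarrow> 'a set set" where
  "graph_power k V E =
     E \<union> {{u, v} | u v. u \<in> V \<and> v \<in> V \<and> u \<noteq> v \<and> graph_dist E u v \<le> enat k}"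

definition spanning_cycle :: "'a set \<Rightarrow> 'a set set \<Rightarrow> bool" where
  "spanning_cycle V C \<longleftrightarrow>
     (\<exists>xs. distinct xs \<and> set xs = V \<and> length xs \<ge> 3 \<and>
           C = {{xs ! i, xs ! (Suc i mod length xs)} | i. i < length xs})"

text \<open>Since \<open>C \<subseteq> graph_power k V C\<close>, the cycle \<open>C\<close> below is a Hamilton cycle of \<open>(V, E)\<close>.\<close>

definition contains_ham_cycle_power :: "nat \<Rightarrow> 'a set \<Rightarrow> 'a set set \<Rightarrow> bool" where
  "contains_ham_cycle_power k V E \<longleftrightarrow> (\<exists>C. spanning_cycle V C \<and> graph_power k V C \<subseteq> E)"

text \<open>The joint law of \<open>n\<close> independent uniform points \<open>X 1, \<dots>, X n\<close> of the unit cube.\<close>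

definition uniform_points :: "nat \<Rightarrow> (nat \<Rightarrow> real ^ 'd) measure" where
  "uniform_points n = Pi\<^sub>M {1..n} (\<lambda>_. uniform_measure lborel (cbox 0 1))"

definition geometric_graph :: "nat \<Rightarrow> real \<Rightarrow> (nat \<Rightarrow> real ^ 'd) \<Rightarrow> nat set set" where
  "geometric_graph n r X =
     {{i, j} | i j. i \<in> {1..n} \<and> j \<in> {1..n} \<and> i \<noteq> j \<and> norm (X i - X j) \<le> r}"

end

theory Submission
  imports Defs
begin

text \<open>
  Upper bound: cut the cube into \<open>N\<close> boxes of diameter at most \<open>r\<close>. The vertices in a box form a clique, and
  \<open>r = \<omega>(n\<^bsup>-1/d\<^esup>)\<close> permits \<open>m = n / N\<close> to be an arbitrarily large constant. By second moments, most cells have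
  about \<open>m\<close> vertices and for most pairs of a vertex \<open>u\<close> and a cell, \<open>u\<close> has at least \<open>\<alpha>m/2\<close> \<open>H\<close>-neighbours in the
  cell. Hence most pairs of cells are dense in \<open>H\<close>, so they contain a copy of \<open>K\<^bsub>k,k\<^esub>\<close>, along which the \<open>k\<close>-th power of a path can pass from one
  clique to the other; a long cycle of such pairs covers all but a small fraction of the vertices. Each
  remaining vertex has \<open>2k\<close> private \<open>H\<close>-neighbours inside one of the cliques (chosen greedily) and is
  inserted between them.

  Lower bound: let \<open>H\<close> be the complete graph with all edges inside a set of \<open>(1 - \<alpha>)n\<close> vertices removed. An independent
  set of the \<open>k\<close>-th power of a Hamilton cycle has at most \<open>n/(k+1) < (1 - \<alpha>)n\<close> vertices, so linearly many
  geometric edges are needed, whereas for \<open>r = o(n\<^bsup>-1/d\<^esup>)\<close> only \<open>o(n)\<close> are expected.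
\<close>

section \<open>Powers of paths and of Hamilton cycles\<close>

text \<open>For a fixed error probability the average cell size \<open>m\<close> stays bounded as
  \<open>n\<close> grows, so one cannot expect all cells to be regular: a small positive proportion
  of the cells may be lost. Hence the leftover vertices can be linearly many, up to
  \<open>4 * \<rho> * n\<close>. This dictates \<open>\<rho>\<close>, a small multiple of
  \<open>\<alpha> / (1 + 2 * k)\<close>: every leftover vertex consumes \<open>2 * k\<close>
  neighbours out of at least \<open>\<alpha> * n\<close>, and neighbours that are themselves
  leftover cannot be used. Most vertex-cell pairs are good because the neighbourhood of
  \<open>u\<close> in \<open>H\<close> is fixed before the points are drawn, so it is a set of at
  least \<open>\<alpha> * n\<close> uniform points and spreads evenly over the cells. Only the
  expectations of two sums of squared deviations enter; once both sums are within a factor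
  \<open>K\<close> of their bounds, the embedding is deterministic. The failure probability
  \<open>2 / K\<close> does not depend on \<open>H\<close>. Constants are fixed in the order
  \<open>e\<close>, \<open>K\<close>, \<open>m0\<close>, and finally the grid size \<open>M\<close>,
  which depends on \<open>n\<close>.\<close>

definition power_path :: "nat \<Rightarrow> 'a set set \<Rightarrow> 'a list \<Rightarrow> bool" where
  "power_path k E xs \<longleftrightarrow> (\<forall>i j. i < j \<longrightarrow> j < length xs \<longrightarrow> j \<le> i + k \<longrightarrow> {xs ! i, xs ! j} \<in> E)"

text \<open>Only pairs across the seam are new, and such a pair has its left end among the last
  \<open>k\<close> entries of \<open>xs\<close> and its right end among the first \<open>k\<close>
  of \<open>ys\<close>. If \<open>xs\<close> is shorter than \<open>k\<close>, the truncated
  difference is 0 and \<open>drop\<close> keeps all of \<open>xs\<close>.\<close>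

lemma power_path_append:
  assumes "power_path k E xs" "power_path k E ys"
    and join: "\<And>a b. a \<in> set (drop (length xs - k) xs) \<Longrightarrow> b \<in> set (take k ys) \<Longrightarrow> {a, b} \<in> E"
  shows "power_path k E (xs @ ys)"
  unfolding power_path_def
proof (intro allI impI)
  fix i j assume ij: "i < j" "j < length (xs @ ys)" "j \<le> i + k"
  consider "j < length xs" | "length xs \<le> i" | "i < length xs" "length xs \<le> j" by linarith
  then show "{(xs @ ys) ! i, (xs @ ys) ! j} \<in> E"
  proof cases
    case 1
    then show ?thesis using assms(1) ij by (auto simp: power_path_def nth_append)
  next
    case 2
    then have "{ys ! (i - length xs), ys ! (j - length xs)} \<in> E"
      using assms(2) ij unfolding power_path_def by auto
    then show ?thesis using 2 ij by (simp add: nth_append)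
  next
    case 3
    have "xs ! i \<in> set (drop (length xs - k) xs)"
      unfolding in_set_conv_nth
      by (rule exI[of _ "i - (length xs - k)"]) (use 3 ij in \<open>auto simp: nth_drop\<close>)
    moreover have "ys ! (j - length xs) \<in> set (take k ys)"
      unfolding in_set_conv_nth
      by (rule exI[of _ "j - length xs"]) (use 3 ij in \<open>auto\<close>)
    ultimately show ?thesis using join 3 by (simp add: nth_append)
  qed
qed

text \<open>Two positions at most \<open>k\<close> apart have at most \<open>k - 1\<close> positions
  strictly between them, so no whole block of length at least \<open>k\<close> fits in the gap.
  Hence only consecutive blocks have to be joined.\<close>

lemma power_path_concat:
  assumes "\<And>b. b \<in> set bs \<Longrightarrow> power_path k E b \<and> k \<le> length b"
    and "\<And>i x y. Suc i < length bs \<Longrightarrow> x \<in> set (drop (length (bs ! i) - k) (bs ! i)) \<Longrightarrow>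
           y \<in> set (take k (bs ! Suc i)) \<Longrightarrow> {x, y} \<in> E"
  shows "power_path k E (concat bs)"
  using assms
proof (induction bs)
  case Nil
  then show ?case by (simp add: power_path_def)
next
  case (Cons b bs)
  have IH: "power_path k E (concat bs)"
  proof (rule Cons.IH)
    show "power_path k E c \<and> k \<le> length c" if "c \<in> set bs" for c
      using Cons.prems(1) that by auto
    show "{x, y} \<in> E" if "Suc i < length bs" "x \<in> set (drop (length (bs ! i) - k) (bs ! i))"
      "y \<in> set (take k (bs ! Suc i))" for i x y
      using Cons.prems(2)[of "Suc i" x y] that by simp
  qed
  show ?case
  proof (cases bs)
    case Nil
    then show ?thesis using Cons.prems(1) by simp
  next
    case (Cons c cs)
    have "k \<le> length c" using Cons.prems(1) Cons by simp
    then have "take k (concat bs) = take k (bs ! 0)" using Cons by simp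
    moreover have "power_path k E b" using Cons.prems(1) by simp
    ultimately have "power_path k E (b @ concat bs)"
      using Cons.prems(2)[of 0] Cons by (intro power_path_append IH) (simp_all only: nth_Cons_0 nth_Cons_Suc, simp)
    then show ?thesis by simp
  qed
qed

section \<open>Passing between walk distances in a cycle and cyclic distances of positions\<close>

definition cycle_edges :: "'a list \<Rightarrow> 'a set set" where
  "cycle_edges xs = {{xs ! i, xs ! (Suc i mod length xs)} | i. i < length xs}"

text \<open>By distinctness a vertex determines its position, and each edge moves the position by 1
  or by -1 modulo the length. The signed total \<open>z\<close> treats both directions of travel at
  once.\<close>

lemma walk_in_cycle_edges:
  assumes "distinct xs" "length xs \<ge> 1" "is_walk (cycle_edges xs) ws" "hd ws = xs ! i" "i < length xs"
    "l < length ws"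
  shows "\<exists>j z. j < length xs \<and> ws ! l = xs ! j \<and> \<bar>z\<bar> \<le> int l \<and> int j = (int i + z) mod int (length xs)"
  using assms(6)
proof (induction l)
  case 0
  have "ws ! 0 = xs ! i" using assms(3,4) by (simp add: is_walk_def hd_conv_nth)
  then show ?case using assms(5) by (intro exI[of _ i] exI[of _ "0::int"]) auto
next
  case (Suc l)
  let ?n = "length xs"
  obtain j z where j: "j < ?n" "ws ! l = xs ! j" "\<bar>z\<bar> \<le> int l" "int j = (int i + z) mod int ?n"
    using Suc by auto
  have "{ws ! l, ws ! Suc l} \<in> cycle_edges xs"
    using assms(3) Suc.prems by (auto simp: is_walk_def)
  then obtain h where h: "h < ?n" "{ws ! l, ws ! Suc l} = {xs ! h, xs ! (Suc h mod ?n)}"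
    by (auto simp: cycle_edges_def)
  have Sh: "Suc h mod ?n < ?n" using h(1) by (intro mod_less_divisor) auto
  consider "ws ! l = xs ! h" "ws ! Suc l = xs ! (Suc h mod ?n)"
    | "ws ! l = xs ! (Suc h mod ?n)" "ws ! Suc l = xs ! h"
    using h(2) by (auto simp: doubleton_eq_iff)
  then show ?case
  proof cases
    case 1
    then have "h = j" using j h(1) assms(1) by (simp add: nth_eq_iff_index_eq)
    then have "int (Suc h mod ?n) = (int i + (z + 1)) mod int ?n"
      using j(4) by (simp add: zmod_int) (metis add.assoc add.commute mod_add_left_eq)
    then show ?thesis using 1 Sh j(3) by (intro exI[of _ "Suc h mod ?n"] exI[of _ "z + 1"]) auto
  next
    case 2
    then have "Suc h mod ?n = j" using j Sh assms(1) by (simp add: nth_eq_iff_index_eq)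
    then have "(int h + 1) mod int ?n = (int i + z) mod int ?n"
      using j(4) by (metis of_nat_Suc add.commute zmod_int)
    then have "(int h + 1 - 1) mod int ?n = (int i + z - 1) mod int ?n"
      by (metis mod_diff_left_eq)
    then have "int h = (int i + (z - 1)) mod int ?n" using h(1) by (simp add: algebra_simps)
    then show ?thesis using 2 h(1) j(3) by (intro exI[of _ h] exI[of _ "z - 1"]) auto
  qed
qed

text \<open>Appending \<open>take k xs\<close> unrolls the cycle just far enough that every forward
  step of length at most \<open>k\<close>, including one across the end, becomes a pair of positions
  in a list.\<close>

lemma power_path_wrap:
  assumes "power_path k E (xs @ take k xs)" "k \<le> length xs"
    "i < length xs" "1 \<le> s" "s \<le> k"
  shows "{xs ! i, xs ! ((i + s) mod length xs)} \<in> E"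
proof (cases "i + s < length xs")
  case True
  have "{(xs @ take k xs) ! i, (xs @ take k xs) ! (i + s)} \<in> E"
    using assms True unfolding power_path_def by auto
  then show ?thesis using True by (simp add: nth_append)
next
  case False
  have "{(xs @ take k xs) ! i, (xs @ take k xs) ! (i + s)} \<in> E"
    using assms False unfolding power_path_def by auto
  moreover have "(i + s) mod length xs = i + s - length xs"
    using False assms by (simp add: le_mod_geq)
  ultimately show ?thesis using False assms by (simp add: nth_append)
qed

text \<open>The power is defined through walks, so what has to be excluded is that a walk of at most
  \<open>k\<close> edges leaves the cyclic window of radius \<open>k\<close>;
  \<open>walk_in_cycle_edges\<close> does this.\<close>

lemma contains_ham_cycle_power_if_power_path:
  assumes "distinct xs" "set xs = V" "3 \<le> length xs" "k \<le> length xs" "1 \<le> k"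
    and pp: "power_path k E (xs @ take k xs)"
  shows "contains_ham_cycle_power k V E"
proof -
  let ?n = "length xs"
  have sc: "spanning_cycle V (cycle_edges xs)"
    unfolding spanning_cycle_def cycle_edges_def using assms by blast
  have fwd: "{xs ! i, xs ! ((i + s) mod ?n)} \<in> E" if "i < ?n" "1 \<le> s" "s \<le> k" for i s
    using power_path_wrap[OF pp] assms that by blast
  have aux: "{xs ! i, xs ! j} \<in> E"
    if ij: "i < ?n" "j < ?n" "i \<noteq> j" "0 \<le> z" "z \<le> int k" "int j = (int i + z) mod int ?n" for i j z
  proof -
    obtain s where s: "z = int s" using ij(4) zero_le_imp_eq_int by blast
    have "j = (i + s) mod ?n" using ij(6) s by (metis of_nat_add of_nat_eq_iff zmod_int)
    moreover have "s \<noteq> 0" using calculation ij by (auto intro: ccontr)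
    ultimately show ?thesis using fwd[of i s] ij s by auto
  qed
  have "graph_power k V (cycle_edges xs) \<subseteq> E"
  proof
    fix e assume "e \<in> graph_power k V (cycle_edges xs)"
    then consider "e \<in> cycle_edges xs"
      | u v where "e = {u, v}" "u \<in> V" "v \<in> V" "u \<noteq> v" "graph_dist (cycle_edges xs) u v \<le> enat k"
      by (auto simp: graph_power_def)
    then show "e \<in> E"
    proof cases
      case 1
      then show ?thesis using fwd[of _ 1] assms(5) by (auto simp: cycle_edges_def)
    next
      case 2
      let ?W = "{enat (length ws - 1) | ws. is_walk (cycle_edges xs) ws \<and> hd ws = u \<and> last ws = v}"
      \<comment> \<open>The infimum of the empty set in \<open>enat\<close> is infinite, so a
        distance at most \<open>k\<close> yields a walk, and the infimum is attained by one.\<close>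
      have W: "?W \<noteq> {}"
      proof
        assume "?W = {}"
        then have "graph_dist (cycle_edges xs) u v = \<infinity>" unfolding graph_dist_def Inf_enat_def by simp
        then show False using 2(5) by simp
      qed
      have "Inf ?W \<in> ?W" unfolding Inf_enat_def if_not_P[OF W] by (rule LeastI_ex) (use W in blast)
      then obtain ws where ws: "is_walk (cycle_edges xs) ws" "hd ws = u" "last ws = v"
        "length ws - 1 \<le> k" using 2(5) unfolding graph_dist_def by auto
      obtain i where i: "i < ?n" "xs ! i = u" using 2(2) assms(2) by (metis in_set_conv_nth)
      have ne: "ws \<noteq> []" using ws(1) by (simp add: is_walk_def)
      obtain j z where j: "j < ?n" "ws ! (length ws - 1) = xs ! j" "\<bar>z\<bar> \<le> int (length ws - 1)"
        "int j = (int i + z) mod int ?n"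
        using walk_in_cycle_edges[OF assms(1) _ ws(1), of i "length ws - 1"] ws(2) i assms(3) ne
        by auto
      have vj: "v = xs ! j" using j(2) ws(3) ne by (simp add: last_conv_nth)
      have "i \<noteq> j" using vj i 2(4) by auto
      have zk: "\<bar>z\<bar> \<le> int k" using j(3) ws(4) by linarith
      show ?thesis
      proof (cases "0 \<le> z")
        case True
        then show ?thesis using aux[of i j z] i j(1,4) zk \<open>i \<noteq> j\<close> vj 2(1) by auto
      next
        case False
        \<comment> \<open>A backward shift from \<open>i\<close> to \<open>j\<close> is a forward
          shift from \<open>j\<close> to \<open>i\<close>, and edges are unordered.\<close>
        have "(int j + (- z)) mod int ?n = (int i + z - z) mod int ?n"
          unfolding j(4) by (metis mod_add_left_eq uminus_add_conv_diff add.commute)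
        then have "int i = (int j + (- z)) mod int ?n" using i(1) by simp
        then show ?thesis using aux[of j i "-z"] i j(1) zk \<open>i \<noteq> j\<close> vj 2(1) False
          by (auto simp: insert_commute)
      qed
    qed
  qed
  then show ?thesis using sc by (auto simp: contains_ham_cycle_power_def)
qed

text \<open>The arc of \<open>s\<close> steps along the cycle is itself a walk witnessing distance
  at most \<open>s\<close>; the bound \<open>s < length xs\<close> makes its ends distinct.\<close>

lemma contains_ham_cycle_power_adjacent:
  assumes "contains_ham_cycle_power k V E"
  obtains xs where "distinct xs" "set xs = V" "length xs \<ge> 3"
    "\<And>i s. i < length xs \<Longrightarrow> 1 \<le> s \<Longrightarrow> s \<le> k \<Longrightarrow> s < length xs \<Longrightarrow>
       {xs ! i, xs ! ((i + s) mod length xs)} \<in> E"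
proof -
  obtain xs where xs: "distinct xs" "set xs = V" "length xs \<ge> 3"
    "graph_power k V (cycle_edges xs) \<subseteq> E"
    using assms unfolding contains_ham_cycle_power_def spanning_cycle_def cycle_edges_def by blast
  let ?n = "length xs"
  have "{xs ! i, xs ! ((i + s) mod ?n)} \<in> E" if is1: "i < ?n" "1 \<le> s" "s \<le> k" "s < ?n" for i s
  proof -
    let ?j = "(i + s) mod ?n"
    let ?ws = "map (\<lambda>l. xs ! ((i + l) mod ?n)) [0..<Suc s]"
    have j: "?j < ?n" using is1 by (intro mod_less_divisor) auto
    have ne: "?j \<noteq> i" using is1 by (cases "i + s < ?n") (auto simp: le_mod_geq)
    have walk: "is_walk (cycle_edges xs) ?ws"
      unfolding is_walk_def
    proof (intro conjI allI impI)
      fix l assume l: "Suc l < length ?ws"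
      have "{xs ! ((i + l) mod ?n), xs ! (Suc ((i + l) mod ?n) mod ?n)} \<in> cycle_edges xs"
        unfolding cycle_edges_def using is1 by (auto intro!: exI[of _ "(i + l) mod ?n"] mod_less_divisor)
      then show "{?ws ! l, ?ws ! Suc l} \<in> cycle_edges xs"
        using l by (simp add: mod_Suc_eq del: upt_Suc)
    qed (simp)
    have hd: "hd ?ws = xs ! i" using is1 by (simp add: hd_map del: upt_Suc)
    have la: "last ?ws = xs ! ?j" by simp
    have "enat s \<in> {enat (length ws - 1) | ws. is_walk (cycle_edges xs) ws \<and> hd ws = xs ! i \<and> last ws = xs ! ?j}"
      using walk hd la by (intro CollectI exI[of _ ?ws]) auto
    then have "graph_dist (cycle_edges xs) (xs ! i) (xs ! ?j) \<le> enat s"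
      unfolding graph_dist_def by (rule Inf_lower)
    also have "enat s \<le> enat k" using is1 by simp
    finally have "graph_dist (cycle_edges xs) (xs ! i) (xs ! ?j) \<le> enat k" .
    moreover have "xs ! i \<in> V" "xs ! ?j \<in> V" "xs ! i \<noteq> xs ! ?j"
      using is1 j ne xs(1,2) by (auto simp: nth_eq_iff_index_eq)
    ultimately have "{xs ! i, xs ! ?j} \<in> graph_power k V (cycle_edges xs)"
      unfolding graph_power_def by blast
    then show ?thesis using xs(4) by auto
  qed
  then show ?thesis using xs that by blast
qed

lemma card_independent_le_if_ham_cycle_power:
  assumes "contains_ham_cycle_power k V E" "A \<subseteq> V" "k < card V"
    and indep: "\<And>a b. a \<in> A \<Longrightarrow> b \<in> A \<Longrightarrow> {a, b} \<notin> E"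
  shows "(k + 1) * card A \<le> card V"
proof -
  obtain xs where xs: "distinct xs" "set xs = V" "length xs \<ge> 3"
    "\<And>i s. i < length xs \<Longrightarrow> 1 \<le> s \<Longrightarrow> s \<le> k \<Longrightarrow> s < length xs \<Longrightarrow>
       {xs ! i, xs ! ((i + s) mod length xs)} \<in> E"
    using contains_ham_cycle_power_adjacent[OF assms(1)] by metis
  let ?n = "length xs"
  have n: "card V = ?n" using xs by (metis distinct_card)
  define I where "I = {i. i < ?n \<and> xs ! i \<in> A}"
  have cI: "card I = card A"
  proof -
    have "A = (!) xs ` I" using assms(2) xs(2) unfolding I_def by (auto simp: image_iff in_set_conv_nth) (metis in_set_conv_nth subsetD)
    moreover have "inj_on ((!) xs) I" using xs(1) by (auto simp: inj_on_def I_def nth_eq_iff_index_eq)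
    ultimately show ?thesis by (simp add: card_image)
  qed
  \<comment> \<open>The windows of \<open>k + 1\<close> consecutive positions starting at the positions in \<open>I\<close> are disjoint.\<close>
  let ?f = "\<lambda>(i, s). (i + s) mod ?n"
  have "inj_on ?f (I \<times> {..k})"
  proof -
    \<comment> \<open>If two windows meet at offsets \<open>s < t\<close>, then \<open>i\<close>
      lies \<open>t - s\<close> steps after \<open>j\<close>, with
      \<open>1 \<le> t - s \<le> k\<close>, so two vertices of \<open>A\<close> would be adjacent.
      Since \<open>k < ?n\<close>, the step does not go all the way round.\<close>
    have key: False if "i \<in> I" "j \<in> I" "s \<le> k" "t \<le> k" "s < t" "(i + s) mod ?n = (j + t) mod ?n" for i j s t
    proof -
      have eq: "i = (j + (t - s)) mod ?n"
      proof -
        have "(int j + int t) mod int ?n = (int i + int s) mod int ?n"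
          using that(6) by (metis of_nat_add zmod_int)
        then have "(int j + int t - int s) mod int ?n = (int i + int s - int s) mod int ?n"
          by (metis mod_diff_left_eq)
        then have "int ((j + (t - s)) mod ?n) = int i"
          using that by (simp add: zmod_int I_def of_nat_diff algebra_simps)
        then show ?thesis by linarith
      qed
      have "{xs ! j, xs ! i} \<in> E"
        unfolding eq by (rule xs(4)) (use that assms(3) n in \<open>auto simp: I_def\<close>)
      then show False using indep that by (auto simp: I_def)
    qed
    have key0: "i = j" if "i \<in> I" "j \<in> I" "(i + s) mod ?n = (j + s) mod ?n" for i j s
    proof -
      have "(int j + int s) mod int ?n = (int i + int s) mod int ?n"
        using that(3) by (metis of_nat_add zmod_int)
      then have "(int j + int s - int s) mod int ?n = (int i + int s - int s) mod int ?n"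
        by (metis mod_diff_left_eq)
      then show ?thesis using that by (simp add: I_def)
    qed
    show ?thesis
    proof (rule inj_onI, clarsimp)
      fix i s j t assume "i \<in> I" "j \<in> I" "s \<le> k" "t \<le> k" and eq: "(i + s) mod ?n = (j + t) mod ?n"
      then show "i = j \<and> s = t" using key[of i j s t] key[of j i t s] key0[of i j s]
        by (metis linorder_neqE_nat)
    qed
  qed
  moreover have "?f ` (I \<times> {..k}) \<subseteq> {..<?n}" using xs(3) by (auto intro: mod_less_divisor)
  ultimately have "card (I \<times> {..k}) \<le> card {..<?n}" by (intro card_inj_on_le) auto
  then show ?thesis using cI n by (simp add: card_cartesian_product mult.commute)
qed

text \<open>Allowing loops lets one treat a clique as complete to itself while power paths are being
  concatenated, without tracking that the vertices of different blocks are distinct.\<close>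

lemma power_path_remove_loops:
  assumes "power_path k (E \<union> range (\<lambda>a. {a})) (xs @ take k xs)" "distinct xs" "k < length xs"
  shows "power_path k E (xs @ take k xs)"
  unfolding power_path_def
proof (intro allI impI)
  fix i j assume ij: "i < j" "j < length (xs @ take k xs)" "j \<le> i + k"
  \<comment> \<open>Positions at most \<open>k < length xs\<close> apart in the unrolled list are
    different positions of the cycle, so none of the edges used can be a loop.\<close>
  have "(xs @ take k xs) ! i \<noteq> (xs @ take k xs) ! j"
    using ij assms(2,3) by (auto simp: nth_append nth_eq_iff_index_eq)
  moreover have "{(xs @ take k xs) ! i, (xs @ take k xs) ! j} \<in> E \<union> range (\<lambda>a. {a})"
    using assms(1) ij unfolding power_path_def by blast
  ultimately show "{(xs @ take k xs) ! i, (xs @ take k xs) ! j} \<in> E"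
    by (auto simp: doubleton_eq_iff)
qed

lemma distinct_concat_map:
  assumes "distinct xs" "\<And>x. x \<in> set xs \<Longrightarrow> distinct (f x)"
    "\<And>x y. x \<in> set xs \<Longrightarrow> y \<in> set xs \<Longrightarrow> x \<noteq> y \<Longrightarrow> set (f x) \<inter> set (f y) = {}"
  shows "distinct (concat (map f xs))"
  using assms
proof (induction xs)
  case (Cons a xs)
  have "set (f a) \<inter> (\<Union>x\<in>set xs. set (f x)) = {}"
    using Cons.prems(1,3) by fastforce
  moreover have "distinct (concat (map f xs))" by (rule Cons.IH) (use Cons.prems in auto)
  ultimately show ?case using Cons.prems(2) by simp
qed simp

text \<open>All out-neighbours of the last vertex of a longest path lie on that path, so closing it up at the
  earliest of them gives a cycle through all of them.\<close>

lemma long_cycle: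
  fixes R :: "'c set" and b :: nat
  assumes fin: "finite R" and deg: "\<And>p. p \<in> R \<Longrightarrow> card {q \<in> R. q \<noteq> p \<and> \<not> rel p q} \<le> b"
    and big: "b + 2 \<le> card R"
  obtains ps where "distinct ps" "set ps \<subseteq> R" "2 \<le> length ps" "card R \<le> length ps + b"
    "\<And>i. Suc i < length ps \<Longrightarrow> rel (ps ! i) (ps ! Suc i)" "rel (last ps) (hd ps)"
proof -
  define P where "P ps \<longleftrightarrow> ps \<noteq> [] \<and> distinct ps \<and> set ps \<subseteq> R \<and>
    (\<forall>i. Suc i < length ps \<longrightarrow> rel (ps ! i) (ps ! Suc i))" for ps
  obtain a where a: "a \<in> R" using big by (metis add_2_eq_Suc' card.empty ex_in_conv le_zero_eq nat.distinct(1))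
  have "P [a]" using a by (simp add: P_def)
  moreover have "\<forall>ps. P ps \<longrightarrow> length ps \<le> card R"
    unfolding P_def by (metis card_mono distinct_card fin)
  ultimately obtain ps where ps: "P ps" and mx: "\<And>qs. P qs \<Longrightarrow> length qs \<le> length ps"
    using ex_has_greatest_nat[of P "[a]" length "Suc (card R)"] by (metis le_imp_less_Suc)
  let ?l = "last ps"
  have ne: "ps \<noteq> []" and dist: "distinct ps" and sub: "set ps \<subseteq> R"
    and chain: "\<And>i. Suc i < length ps \<Longrightarrow> rel (ps ! i) (ps ! Suc i)"
    using ps by (auto simp: P_def)
  have lR: "?l \<in> R" using ne sub by auto
  define out where "out = {q \<in> R. q \<noteq> ?l \<and> rel ?l q}"
  have out_sub: "out \<subseteq> set ps"
  proof
    fix q assume q: "q \<in> out"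
    show "q \<in> set ps"
    proof (rule ccontr)
      assume nq: "q \<notin> set ps"
      have "P (ps @ [q])" unfolding P_def
      proof (intro conjI allI impI)
        fix i assume "Suc i < length (ps @ [q])"
        then consider "Suc i < length ps" | "i = length ps - 1" "Suc i = length ps" using ne by (auto simp: less_Suc_eq)
        then show "rel ((ps @ [q]) ! i) ((ps @ [q]) ! Suc i)"
          using chain[of i] q ne by cases (auto simp: nth_append out_def last_conv_nth)
      qed (use dist sub nq q in \<open>auto simp: out_def\<close>)
      from mx[OF this] show False by simp
    qed
  qed
  \<comment> \<open>The three summands are the out-neighbours of \<open>?l\<close>, the vertex
    \<open>?l\<close> itself, and the at most \<open>b\<close> vertices to which it is not
    related.\<close>
  have cout: "card R \<le> card out + 1 + b"
  proof -
    have "R = insert ?l out \<union> {q \<in> R. q \<noteq> ?l \<and> \<not> rel ?l q}" using lR by (auto simp: out_def)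
    then have "card R \<le> card (insert ?l out) + card {q \<in> R. q \<noteq> ?l \<and> \<not> rel ?l q}"
      by (metis card_Un_le)
    also have "card (insert ?l out) \<le> card out + 1" by (simp add: card_insert_le_m1 card_insert_if)
    finally show ?thesis using deg[OF lR] by linarith
  qed
  have "out \<noteq> {}" using cout big by auto
  then have ex: "\<exists>i. i < length ps \<and> ps ! i \<in> out" using out_sub by (metis ex_in_conv in_set_conv_nth subsetD)
  define i where "i = (LEAST i. i < length ps \<and> ps ! i \<in> out)"
  have i: "i < length ps" "ps ! i \<in> out" using LeastI_ex[OF ex] by (auto simp: i_def)
  have least: "i \<le> j" if "j < length ps" "ps ! j \<in> out" for j
    unfolding i_def by (rule Least_le) (use that in blast)
  let ?ds = "drop i ps"
  have dne: "?ds \<noteq> []" using i by simp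
  have "insert ?l out \<subseteq> set ?ds"
  proof
    fix q assume "q \<in> insert ?l out"
    then show "q \<in> set ?ds"
    proof
      assume "q = ?l"
      then show ?thesis using dne by (metis last_drop last_in_set i(1))
    next
      assume q: "q \<in> out"
      then obtain j where j: "j < length ps" "ps ! j = q" using out_sub by (metis in_set_conv_nth subsetD)
      then have "i \<le> j" using least q by auto
      then show ?thesis unfolding in_set_conv_nth
        using j by (intro exI[of _ "j - i"]) auto
    qed
  qed
  moreover have "?l \<notin> out" by (simp add: out_def)
  moreover have "finite out" using fin by (simp add: out_def)
  ultimately have "card out + 1 \<le> card (set ?ds)"
    by (metis List.finite_set Suc_eq_plus1 card_insert_disjoint card_mono)
  then have len: "card out + 1 \<le> length ?ds" by (meson card_length le_trans)
  show ?thesis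
  proof (rule that[of ?ds])
    show "distinct ?ds" using dist by simp
    show "set ?ds \<subseteq> R" using sub by (meson set_drop_subset subset_trans)
    show "2 \<le> length ?ds" using len cout big by linarith
    show "card R \<le> length ?ds + b" using len cout by linarith
    show "rel (?ds ! j) (?ds ! Suc j)" if "Suc j < length ?ds" for j
      using chain[of "i + j"] that by simp
    show "rel (last ?ds) (hd ?ds)" using i dne by (simp add: hd_drop_conv_nth out_def)
  qed
qed

section \<open>Common neighbourhoods and private neighbours\<close>

text \<open>A Kovari-Sos-Turan count. On average a vertex of \<open>B\<close> is seen by at least
  \<open>t * \<gamma> \<ge> 2 * k\<close> members of \<open>S0\<close>, so at least
  \<open>k * card B / t\<close> of them are seen by \<open>k\<close> or more. Assigning to each of
  these a \<open>k\<close>-subset that sees it and applying the pigeonhole principle to the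
  \<open>2 ^ t\<close> subsets of \<open>S0\<close> gives one \<open>S\<close> with many common
  neighbours.\<close>

lemma common_neighbours:
  fixes N :: "'a \<Rightarrow> 'b set" and \<gamma> :: real
  assumes fin: "finite S0" "finite B" and t: "card S0 = t"
    and deg: "\<And>u. u \<in> S0 \<Longrightarrow> \<gamma> * card B \<le> card (N u \<inter> B)"
    and tg: "2 * real k \<le> t * \<gamma>" and big: "c * t * 2 ^ t < k * card B"
  obtains S where "S \<subseteq> S0" "card S = k" "c \<le> card {b \<in> B. \<forall>u\<in>S. b \<in> N u}"
proof -
  define cnt where "cnt b = card {u \<in> S0. b \<in> N u}" for b
  define Bs where "Bs = {b \<in> B. k \<le> cnt b}"
  have fBs: "finite Bs" using fin by (simp add: Bs_def)
  have cntt: "cnt b \<le> t" for b unfolding cnt_def using fin t by (metis (no_types, lifting) card_mono mem_Collect_eq subsetI)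
  have "(\<Sum>b\<in>B. cnt b) = (\<Sum>u\<in>S0. card (N u \<inter> B))"
  proof -
    have "(\<Sum>b\<in>B. cnt b) = (\<Sum>b\<in>B. \<Sum>u\<in>S0. if b \<in> N u then 1 else 0)"
      using fin by (simp add: cnt_def sum.If_cases Int_def)
    also have "\<dots> = (\<Sum>u\<in>S0. \<Sum>b\<in>B. if b \<in> N u then 1 else 0)" by (rule sum.swap)
    also have "\<dots> = (\<Sum>u\<in>S0. card (N u \<inter> B))"
      using fin by (simp add: sum.If_cases Int_def conj_commute)
    finally show ?thesis .
  qed
  then have s1: "real (\<Sum>b\<in>B. cnt b) = (\<Sum>u\<in>S0. real (card (N u \<inter> B)))" by simp
  have "t * (\<gamma> * card B) \<le> (\<Sum>u\<in>S0. real (card (N u \<inter> B)))"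
    using sum_mono[of S0 "\<lambda>_. \<gamma> * card B" "\<lambda>u. real (card (N u \<inter> B))"] deg t by simp
  moreover have "2 * real k * card B \<le> t * \<gamma> * card B" using tg by (intro mult_right_mono) auto
  ultimately have "2 * real k * card B \<le> real (\<Sum>b\<in>B. cnt b)" using s1 by (simp add: mult.assoc)
  then have s2: "2 * k * card B \<le> (\<Sum>b\<in>B. cnt b)"
    by (metis of_nat_le_iff of_nat_mult of_nat_numeral)
  \<comment> \<open>A vertex outside \<open>Bs\<close> contributes less than \<open>k\<close>, one
    inside at most \<open>t\<close>; comparison with the lower bound \<open>2 * k * card B\<close>
    makes \<open>Bs\<close> large.\<close>
  have "(\<Sum>b\<in>B. cnt b) \<le> (\<Sum>b\<in>B. k + (if b \<in> Bs then t else 0))"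
    using cntt by (intro sum_mono) (auto simp: Bs_def intro: trans_le_add2)
  also have "\<dots> = k * card B + t * card Bs"
    using fin by (simp add: sum.distrib sum.If_cases Bs_def Int_def mult.commute)
  finally have s3: "k * card B \<le> t * card Bs" using s2 by linarith
  have "\<exists>S. S \<subseteq> {u \<in> S0. b \<in> N u} \<and> card S = k" if "b \<in> Bs" for b
    using that obtain_subset_with_card_n[of k "{u \<in> S0. b \<in> N u}"] by (auto simp: Bs_def cnt_def)
  then obtain g where g: "\<And>b. b \<in> Bs \<Longrightarrow> g b \<subseteq> {u \<in> S0. b \<in> N u} \<and> card (g b) = k" by metis
  have "\<exists>S\<in>Pow S0. c < card {b \<in> Bs. g b = S}"
  proof (rule ccontr)
    assume neg: "\<not> ?thesis"
    have "Bs \<subseteq> (\<Union>S\<in>Pow S0. {b \<in> Bs. g b = S})" using g by fastforce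
    then have "card Bs \<le> card (\<Union>S\<in>Pow S0. {b \<in> Bs. g b = S})"
      using fin fBs by (intro card_mono finite_UN_I) auto
    also have "\<dots> \<le> (\<Sum>S\<in>Pow S0. card {b \<in> Bs. g b = S})" using fin by (intro card_UN_le) auto
    also have "\<dots> \<le> (\<Sum>S\<in>Pow S0. c)" using neg by (intro sum_mono) (auto simp: not_less)
    also have "\<dots> = 2 ^ t * c" using fin t by (simp add: card_Pow)
    finally have "t * card Bs \<le> t * (2 ^ t * c)" by (intro mult_left_mono) auto
    also have "\<dots> = c * t * 2 ^ t" by (simp only: mult_ac)
    finally show False using s3 big by linarith
  qed
  then obtain S where S: "c < card {b \<in> Bs. g b = S}" by auto
  then have "{b \<in> Bs. g b = S} \<noteq> {}" by (metis card.empty not_less_zero)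
  then obtain b0 where b0: "b0 \<in> Bs" "g b0 = S" by auto
  have "card {b \<in> Bs. g b = S} \<le> card {b \<in> B. \<forall>u\<in>S. b \<in> N u}"
    using fin g by (intro card_mono) (auto simp: Bs_def)
  then show ?thesis using that[of S] S g[OF b0(1)] b0(2) by auto
qed

text \<open>Greedy choice. The vertices served so far block at most \<open>l\<close> elements each.
  If every \<open>F p\<close> had fewer than \<open>l\<close> free neighbours left, the total would
  fall below the assumed degree. All of \<open>g u\<close> must lie in a single \<open>F p\<close>,
  because \<open>u\<close> is later inserted inside one clique.\<close>

lemma disjoint_absorbers:
  fixes N :: "'a \<Rightarrow> 'b set" and F :: "'c \<Rightarrow> 'b set"
  assumes "finite U" "finite D" "\<And>p. p \<in> D \<Longrightarrow> finite (F p)" "card U \<le> b" "1 \<le> l"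
    "\<And>u. u \<in> U \<Longrightarrow> l * b + l * card D \<le> card (N u \<inter> (\<Union>p\<in>D. F p))"
  shows "\<exists>c g. \<forall>u\<in>U. c u \<in> D \<and> g u \<subseteq> F (c u) \<inter> N u \<and> card (g u) = l \<and>
            (\<forall>v\<in>U. u \<noteq> v \<longrightarrow> g u \<inter> g v = {})"
  using assms
proof (induction U)
  case empty
  then show ?case by auto
next
  case (insert x U)
  have "\<exists>c g. \<forall>u\<in>U. c u \<in> D \<and> g u \<subseteq> F (c u) \<inter> N u \<and> card (g u) = l \<and>
            (\<forall>v\<in>U. u \<noteq> v \<longrightarrow> g u \<inter> g v = {})"
    by (rule insert.IH) (use insert.prems insert.hyps in auto)
  then obtain c g where cg: "\<And>u. u \<in> U \<Longrightarrow> c u \<in> D \<and> g u \<subseteq> F (c u) \<inter> N u \<and> card (g u) = l \<and>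
            (\<forall>v\<in>U. u \<noteq> v \<longrightarrow> g u \<inter> g v = {})" by blast
  define W where "W = (\<Union>u\<in>U. g u)"
  have fg: "finite (g u)" if "u \<in> U" for u
    using cg[OF that] insert.prems(4) by (intro card_ge_0_finite) auto
  have fW: "finite W" unfolding W_def using insert.hyps(1) fg by (intro finite_UN_I) auto
  have "card W \<le> (\<Sum>u\<in>U. card (g u))" unfolding W_def by (rule card_UN_le) (rule insert.hyps)
  also have "\<dots> = card U * l" using cg by simp
  finally have cW: "card W \<le> card U * l" .
  have "\<exists>p\<in>D. l \<le> card (F p \<inter> N x - W)"
  proof (rule ccontr)
    assume neg: "\<not> ?thesis"
    have "N x \<inter> (\<Union>p\<in>D. F p) \<subseteq> W \<union> (\<Union>p\<in>D. F p \<inter> N x - W)" by auto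
    then have "card (N x \<inter> (\<Union>p\<in>D. F p)) \<le> card (W \<union> (\<Union>p\<in>D. F p \<inter> N x - W))"
      using insert.prems(1,2) fW by (intro card_mono) auto
    also have "\<dots> \<le> card W + card (\<Union>p\<in>D. F p \<inter> N x - W)" by (rule card_Un_le)
    also have "card (\<Union>p\<in>D. F p \<inter> N x - W) \<le> (\<Sum>p\<in>D. card (F p \<inter> N x - W))"
      using insert.prems(1) by (rule card_UN_le)
    also have "\<dots> \<le> (\<Sum>p\<in>D. l)" using neg by (intro sum_mono) force
    finally have "card (N x \<inter> (\<Union>p\<in>D. F p)) \<le> l * card U + l * card D"
      using cW by (simp add: mult.commute)
    moreover have "l * Suc (card U) \<le> l * b" using insert.prems(3) insert.hyps by (intro mult_le_mono2) simp
    ultimately show False using insert.prems(4) insert.prems(5)[of x] by simp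
  qed
  then obtain p where p: "p \<in> D" "l \<le> card (F p \<inter> N x - W)" by blast
  then obtain S where S: "S \<subseteq> F p \<inter> N x - W" "card S = l" by (metis obtain_subset_with_card_n)
  have SW: "S \<inter> g u = {}" if "u \<in> U" for u using S that by (auto simp: W_def)
  show ?case
    using cg S p(1) SW insert.hyps(2)
    by (intro exI[of _ "c(x := p)"] exI[of _ "g(x := S)"]) (auto simp: Int_commute)
qed

text \<open>The cycle traverses the cliques \<open>A p\<close> in the order \<open>ps\<close>, entering \<open>A p\<close> through \<open>T p\<close> and leaving it
  through \<open>S p\<close>. A vertex \<open>u\<close> outside the cliques is placed between two halves of \<open>g u\<close>, so that its \<open>k\<close>
  predecessors and its \<open>k\<close> successors all belong to \<open>g u\<close>.\<close>

lemma ham_cycle_power_assembly: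
  fixes A :: "'c \<Rightarrow> 'a set"
  assumes ps: "distinct ps" "2 \<le> length ps" and k: "1 \<le> k"
    and finA: "\<And>p. p \<in> set ps \<Longrightarrow> finite (A p)"
    and disA: "\<And>p q. p \<in> set ps \<Longrightarrow> q \<in> set ps \<Longrightarrow> p \<noteq> q \<Longrightarrow> A p \<inter> A q = {}"
    and clique: "\<And>p a b. p \<in> set ps \<Longrightarrow> a \<in> A p \<Longrightarrow> b \<in> A p \<Longrightarrow> a \<noteq> b \<Longrightarrow> {a, b} \<in> E"
    and S: "\<And>p. p \<in> set ps \<Longrightarrow> S p \<subseteq> A p \<and> card (S p) = k"
    and T: "\<And>p. p \<in> set ps \<Longrightarrow> T p \<subseteq> A p \<and> card (T p) = k"
    and ST: "\<And>p. p \<in> set ps \<Longrightarrow> S p \<inter> T p = {}"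
    and join: "\<And>i a b. Suc i < length ps \<Longrightarrow> a \<in> S (ps ! i) \<Longrightarrow> b \<in> T (ps ! Suc i) \<Longrightarrow> {a, b} \<in> E"
      "\<And>a b. a \<in> S (last ps) \<Longrightarrow> b \<in> T (hd ps) \<Longrightarrow> {a, b} \<in> E"
    and U: "finite U" "\<And>p. p \<in> set ps \<Longrightarrow> U \<inter> A p = {}"
    and c: "\<And>u. u \<in> U \<Longrightarrow> c u \<in> set ps"
    and g: "\<And>u. u \<in> U \<Longrightarrow> g u \<subseteq> A (c u) - S (c u) - T (c u) \<and> card (g u) = 2 * k"
      "\<And>u v. u \<in> U \<Longrightarrow> v \<in> U \<Longrightarrow> u \<noteq> v \<Longrightarrow> g u \<inter> g v = {}"
      "\<And>u a. u \<in> U \<Longrightarrow> a \<in> g u \<Longrightarrow> {u, a} \<in> E"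
  shows "contains_ham_cycle_power k (U \<union> (\<Union>p\<in>set ps. A p)) E"
proof -
  define ls :: "'a set \<Rightarrow> 'a list" where "ls X = (SOME xs. set xs = X \<and> distinct xs)" for X
  have ls: "set (ls X) = X \<and> distinct (ls X)" if "finite X" for X
    unfolding ls_def by (rule someI_ex[OF finite_distinct_list[OF that]])
  have len_ls: "length (ls X) = card X" if "finite X" for X using ls[OF that] by (metis distinct_card)
  define E' where "E' = E \<union> range (\<lambda>a. {a})"
  have EE: "e \<in> E \<Longrightarrow> e \<in> E'" for e by (simp add: E'_def)
  have clique': "{a, b} \<in> E'" if "p \<in> set ps" "a \<in> A p" "b \<in> A p" for p a b
    using clique[OF that] by (cases "a = b") (auto simp: E'_def)
  define Up where "Up p = {u \<in> U. c u = p}" for p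
  define rest where "rest p = A p - S p - T p - (\<Union>u\<in>Up p. g u)" for p
  define gad where "gad u = take k (ls (g u)) @ [u] @ drop k (ls (g u))" for u
  \<comment> \<open>\<open>rest p\<close> may be shorter than \<open>k\<close> or empty, so it is
    glued to \<open>T p\<close> in order that every block has length at least \<open>k\<close>, as
    \<open>power_path_concat\<close> demands.\<close>
  define bl where "bl p = (ls (T p) @ ls (rest p)) # map gad (ls (Up p)) @ [ls (S p)]" for p
  define W where "W p = concat (bl p)" for p
  have fUp: "finite (Up p)" for p using U by (simp add: Up_def)
  have Up_ls: "set (ls (Up p)) = Up p" "distinct (ls (Up p))" for p using ls[OF fUp] by auto
  have fg: "finite (g u)" if "u \<in> U" for u
    using g(1)[OF that] k by (intro card_ge_0_finite) auto
  have g_ls: "set (ls (g u)) = g u" "distinct (ls (g u))" "length (ls (g u)) = 2 * k" if "u \<in> U" for u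
    using ls[OF fg[OF that]] len_ls[OF fg[OF that]] g(1)[OF that] by auto
  have fin: "finite (S p)" "finite (T p)" "finite (rest p)" if "p \<in> set ps" for p
    using finA[OF that] S[OF that] T[OF that] by (auto simp: rest_def intro: finite_subset)
  have S_ls: "set (ls (S p)) = S p" "distinct (ls (S p))" "length (ls (S p)) = k"
    and T_ls: "set (ls (T p)) = T p" "distinct (ls (T p))" "length (ls (T p)) = k"
    and r_ls: "set (ls (rest p)) = rest p" "distinct (ls (rest p))" if "p \<in> set ps" for p
    using ls[OF fin(1)[OF that]] ls[OF fin(2)[OF that]] ls[OF fin(3)[OF that]]
      len_ls[OF fin(1)[OF that]] len_ls[OF fin(2)[OF that]] S[OF that] T[OF that] by auto
  have set_gad: "set (gad u) = insert u (g u)" if "u \<in> U" for u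
  proof -
    have "set (take k (ls (g u))) \<union> set (drop k (ls (g u))) = g u"
      using g_ls[OF that] by (metis append_take_drop_id set_append)
    then show ?thesis unfolding gad_def by auto
  qed
  have gA: "g u \<subseteq> A (c u)" if "u \<in> U" for u using g(1)[OF that] by auto
  have dist_gad: "distinct (gad u)" if "u \<in> U" for u
  proof -
    have "distinct (take k (ls (g u)) @ drop k (ls (g u)))" using g_ls[OF that] by simp
    moreover have "u \<notin> set (take k (ls (g u)) @ drop k (ls (g u)))"
      using g_ls[OF that] gA[OF that] U(2)[OF c[OF that]] that by auto
    ultimately show ?thesis unfolding gad_def by (auto simp del: append_take_drop_id)
  qed
  have pp_gad: "power_path k E' (gad u)" if "u \<in> U" for u
  proof -
    let ?x = "take k (ls (g u))" and ?y = "drop k (ls (g u))"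
    have sub: "set ?x \<subseteq> g u" "set ?y \<subseteq> g u" using g_ls[OF that] by (auto dest: in_set_takeD in_set_dropD)
    have cl: "power_path k E' zs" if "set zs \<subseteq> g u" for zs
      unfolding power_path_def using clique'[OF c[OF \<open>u \<in> U\<close>]] gA[OF \<open>u \<in> U\<close>] that
      by (metis nth_mem order.strict_trans subsetD)
    have 1: "power_path k E' ([u] @ ?y)"
    proof (rule power_path_append[OF _ cl[OF sub(2)]])
      show "power_path k E' [u]" by (simp add: power_path_def)
      fix a b assume "a \<in> set (drop (length [u] - k) [u])" "b \<in> set (take k ?y)"
      then have "a = u" "b \<in> g u" using sub by (auto dest!: in_set_takeD in_set_dropD[of a])
      then show "{a, b} \<in> E'" using g(3)[OF that] EE by auto
    qed
    have "power_path k E' (?x @ ([u] @ ?y))"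
    proof (rule power_path_append[OF cl[OF sub(1)] 1])
      fix a b assume a: "a \<in> set (drop (length ?x - k) ?x)" and b: "b \<in> set (take k ([u] @ ?y))"
      have a': "a \<in> g u" using a sub by (auto dest: in_set_dropD)
      have "b = u \<or> b \<in> g u" using b sub by (auto dest!: in_set_takeD)
      then show "{a, b} \<in> E'"
        using EE[OF g(3)[OF that a']] clique'[OF c[OF that]] gA[OF that] a' by (auto simp: insert_commute)
    qed
    then show ?thesis by (simp add: gad_def)
  qed
  have W_eq: "W p = ls (T p) @ ls (rest p) @ concat (map gad (ls (Up p))) @ ls (S p)" for p
    by (simp add: W_def bl_def)
  have set_gads: "set (concat (map gad (ls (Up p)))) = Up p \<union> (\<Union>u\<in>Up p. g u)" for p
    using set_gad Up_ls by (auto simp: Up_def)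
  have gsub: "g u \<subseteq> A p - S p - T p" if "u \<in> Up p" for u p using g(1)[of u] that by (auto simp: Up_def)
  have setW: "set (W p) = A p \<union> Up p" if "p \<in> set ps" for p
    unfolding W_eq set_append set_gads S_ls[OF that] T_ls[OF that] r_ls[OF that]
    using S[OF that] T[OF that] gsub[of _ p] by (auto simp: rest_def)
  have distW: "distinct (W p)" if "p \<in> set ps" for p
  proof -
    have "distinct (concat (map gad (ls (Up p))))"
    proof (rule distinct_concat_map)
      show "distinct (ls (Up p))" by (rule Up_ls)
      fix u v assume "u \<in> set (ls (Up p))"
      then have u: "u \<in> U" "c u = p" unfolding Up_ls by (auto simp: Up_def)
      show "distinct (gad u)" by (rule dist_gad[OF u(1)])
      assume "v \<in> set (ls (Up p))" "u \<noteq> v"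
      then have v: "v \<in> U" "c v = p" "u \<noteq> v" unfolding Up_ls by (auto simp: Up_def)
      show "set (gad u) \<inter> set (gad v) = {}"
        unfolding set_gad[OF u(1)] set_gad[OF v(1)]
        using g(2)[OF u(1) v(1) v(3)] gA[OF u(1)] gA[OF v(1)] u v U(2)[OF that] by auto
    qed
    moreover have "T p \<inter> (rest p \<union> ((Up p \<union> (\<Union>u\<in>Up p. g u)) \<union> S p)) = {}"
      "rest p \<inter> ((Up p \<union> (\<Union>u\<in>Up p. g u)) \<union> S p) = {}" "(Up p \<union> (\<Union>u\<in>Up p. g u)) \<inter> S p = {}"
      using ST[OF that] gsub[of _ p] U(2)[OF that] S[OF that] T[OF that] by (auto simp: rest_def Up_def)
    ultimately show ?thesis
      unfolding W_eq distinct_append set_append set_gads S_ls(1)[OF that] T_ls(1)[OF that] r_ls(1)[OF that]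
      using S_ls(2)[OF that] T_ls(2)[OF that] r_ls(2)[OF that] by blast
  qed
  have takeW: "take k (W p) = ls (T p)" and lenW: "k \<le> length (W p)"
    and dropW: "drop (length (W p) - k) (W p) = ls (S p)" if "p \<in> set ps" for p
    using S_ls[OF that] T_ls[OF that] by (simp_all add: W_eq)
  have ppW: "power_path k E' (W p)" if p: "p \<in> set ps" for p
    unfolding W_def
  proof (rule power_path_concat)
    have TR: "set (ls (T p) @ ls (rest p)) \<subseteq> A p" "set (ls (S p)) \<subseteq> A p"
      using S_ls[OF p] T_ls[OF p] r_ls[OF p] S[OF p] T[OF p] by (auto simp: rest_def)
    have cl: "power_path k E' zs" if "set zs \<subseteq> A p" for zs
      unfolding power_path_def using clique'[OF p] that
      by (metis nth_mem order.strict_trans subsetD)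
    have all: "power_path k E' b \<and> k \<le> length b \<and> set (take k b) \<subseteq> A p \<and> set (drop (length b - k) b) \<subseteq> A p"
      if "b \<in> set (bl p)" for b
    proof -
      consider "b = ls (T p) @ ls (rest p)" | "b = ls (S p)" | u where "u \<in> Up p" "b = gad u"
        using \<open>b \<in> set (bl p)\<close> by (auto simp: bl_def Up_ls)
      then show ?thesis
      proof cases
        case 1
        then show ?thesis using cl[OF TR(1)] TR T_ls[OF p]
          by (auto dest!: in_set_dropD)
      next
        case 2
        then show ?thesis using cl[OF TR(2)] TR S_ls[OF p] by (auto dest!: in_set_dropD in_set_takeD)
      next
        case 3
        then have u: "u \<in> U" "c u = p" by (auto simp: Up_def)
        have "length (gad u) = Suc (2 * k)" using g_ls[OF u(1)] by (simp add: gad_def)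
        then show ?thesis using 3 pp_gad[OF u(1)] gA[OF u(1)] u g_ls[OF u(1)]
          by (auto simp: gad_def dest!: in_set_dropD in_set_takeD)
      qed
    qed
    show "power_path k E' b \<and> k \<le> length b" if "b \<in> set (bl p)" for b using all[OF that] by auto
    show "{x, y} \<in> E'" if "Suc i < length (bl p)" "x \<in> set (drop (length (bl p ! i) - k) (bl p ! i))"
      "y \<in> set (take k (bl p ! Suc i))" for i x y
      using all[of "bl p ! i"] all[of "bl p ! Suc i"] that by (intro clique'[OF p]) auto
  qed
  define xs where "xs = concat (map W ps)"
  obtain p0 ps' where ps0: "ps = p0 # ps'" using ps by (cases ps) auto
  have p0: "p0 \<in> set ps" using ps0 by simp
  have take_xs: "take k xs = ls (T p0)" using takeW[OF p0] lenW[OF p0] by (simp add: xs_def ps0)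
  \<comment> \<open>The extra block \<open>ls (T p0)\<close> equals \<open>take k xs\<close>, so
    this is the unrolled cycle and the last seam is the closing one.\<close>
  have "power_path k E' (concat (map W ps @ [ls (T p0)]))"
  proof (rule power_path_concat)
    fix b assume "b \<in> set (map W ps @ [ls (T p0)])"
    then consider p where "p \<in> set ps" "b = W p" | "b = ls (T p0)" by auto
    then show "power_path k E' b \<and> k \<le> length b"
    proof cases
      case 1 then show ?thesis using ppW lenW by auto
    next
      case 2
      have "set (ls (T p0)) \<subseteq> A p0" using T_ls[OF p0] T[OF p0] by auto
      then have "power_path k E' (ls (T p0))"
        unfolding power_path_def using clique'[OF p0] by (metis nth_mem order.strict_trans subsetD)
      then show ?thesis using 2 T_ls[OF p0] by simp
    qed
  next
    fix i x y
    let ?bs = "map W ps @ [ls (T p0)]"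
    assume i: "Suc i < length ?bs" and x: "x \<in> set (drop (length (?bs ! i) - k) (?bs ! i))"
      and y: "y \<in> set (take k (?bs ! Suc i))"
    have ip: "i < length ps" "ps ! i \<in> set ps" using i by auto
    have x': "x \<in> S (ps ! i)" using x ip dropW[OF ip(2)] S_ls[OF ip(2)] by (simp add: nth_append)
    show "{x, y} \<in> E'"
    proof (cases "Suc i < length ps")
      case True
      then have q: "ps ! Suc i \<in> set ps" by simp
      have "y \<in> T (ps ! Suc i)" using y True takeW[OF q] T_ls[OF q] by (simp add: nth_append)
      then show ?thesis using join(1)[OF True x'] EE by auto
    next
      case False
      then have "i = length ps - 1" "ps \<noteq> []" using ip ps0 by auto
      then have "x \<in> S (last ps)" using x' by (simp add: last_conv_nth)
      moreover have "y \<in> T (hd ps)"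
      proof -
        have "Suc i = length ps" using False ip by simp
        then have "?bs ! Suc i = ls (T p0)" by (metis length_map nth_append_length)
        then have "y \<in> set (ls (T p0))" using y by (metis in_set_takeD)
        then show ?thesis using T_ls(1)[OF p0] ps0 by simp
      qed
      ultimately show ?thesis using join(2) EE by auto
    qed
  qed
  then have pp: "power_path k E' (xs @ take k xs)" unfolding take_xs by (simp add: xs_def)
  have dist: "distinct xs" unfolding xs_def
  proof (rule distinct_concat_map[OF ps(1)])
    fix p q assume p: "p \<in> set ps"
    show "distinct (W p)" by (rule distW[OF p])
    assume q: "q \<in> set ps" "p \<noteq> q"
    show "set (W p) \<inter> set (W q) = {}"
      unfolding setW[OF p] setW[OF q(1)] using disA[OF p q] U(2)[OF p] U(2)[OF q(1)] q(2)
      by (auto simp: Up_def)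
  qed
  have "set xs = (\<Union>p\<in>set ps. A p \<union> Up p)" using setW by (simp add: xs_def)
  also have "\<dots> = U \<union> (\<Union>p\<in>set ps. A p)" using c by (auto simp: Up_def)
  finally have set_xs: "set xs = U \<union> (\<Union>p\<in>set ps. A p)" .
  \<comment> \<open>Two cells with \<open>2 * k\<close> vertices each in \<open>S\<close> and
    \<open>T\<close> give length at least \<open>4 * k\<close>, which exceeds both \<open>k\<close>
    and 3.\<close>
  have len: "4 * k \<le> length xs"
  proof -
    obtain p1 ps'' where ps1: "ps' = p1 # ps''" using ps ps0 by (cases ps') auto
    have p1: "p1 \<in> set ps" using ps0 ps1 by simp
    have "2 * k \<le> length (W p)" if "p \<in> set ps" for p using S_ls[OF that] T_ls[OF that] by (simp add: W_eq)
    from this[OF p0] this[OF p1] show ?thesis by (simp add: xs_def ps0 ps1)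
  qed
  show ?thesis
    using power_path_remove_loops[OF pp[unfolded E'_def] dist] dist set_xs len k
    by (intro contains_ham_cycle_power_if_power_path) auto
qed

section \<open>Cliques on regular cells\<close>

text \<open>Markov's inequality for counting measure; applied to squared deviations it acts as
  Chebyshev's inequality.\<close>

lemma card_level_set_le:
  fixes f :: "'a \<Rightarrow> real"
  assumes "finite X" "\<And>x. x \<in> X \<Longrightarrow> 0 \<le> f x" "\<And>x. x \<in> X \<Longrightarrow> P x \<Longrightarrow> c \<le> f x"
  shows "c * card {x \<in> X. P x} \<le> sum f X"
proof -
  have "c * card {x \<in> X. P x} = (\<Sum>x\<in>{x \<in> X. P x}. c)" by simp
  also have "\<dots> \<le> sum f {x \<in> X. P x}" using assms by (intro sum_mono) auto
  also have "\<dots> \<le> sum f X" using assms by (intro sum_mono2) auto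
  finally show ?thesis .
qed

text \<open>Here \<open>m\<close> is the average size of a cell, and \<open>dev\<close> and \<open>degdev\<close> say that up to the constant \<open>K\<close> the cell
  sizes and the degrees into the cells deviate from their means as for independent uniform points.\<close>

lemma ham_cycle_power_if_regular_cells:
  fixes V :: "'a set" and I :: "'c set" and m \<rho> \<alpha> K :: real and k t :: nat
  assumes finV: "finite V" and finI: "finite I" and I6: "6 \<le> card I"
    and AV: "\<And>p. p \<in> I \<Longrightarrow> A p \<subseteq> V" and disj: "\<And>p q. p \<in> I \<Longrightarrow> q \<in> I \<Longrightarrow> p \<noteq> q \<Longrightarrow> A p \<inter> A q = {}"
    and clique: "\<And>p a b. p \<in> I \<Longrightarrow> a \<in> A p \<Longrightarrow> b \<in> A p \<Longrightarrow> a \<noteq> b \<Longrightarrow> {a, b} \<in> E"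
    and Nb: "\<And>u. u \<in> V \<Longrightarrow> Nb u \<subseteq> V" "\<And>u v. u \<in> V \<Longrightarrow> v \<in> Nb u \<Longrightarrow> {u, v} \<in> E"
      "\<And>u. u \<in> V \<Longrightarrow> \<alpha> * card V \<le> card (Nb u)"
    and dev: "(\<Sum>q\<in>I. (card (A q) - m)\<^sup>2) \<le> K * card V"
    and degdev: "(\<Sum>u\<in>V. \<Sum>q\<in>I. (card (Nb u \<inter> A q) - card (Nb u) / card I)\<^sup>2) \<le> K * (card V)\<^sup>2"
    and m: "m = card V / card I"
    and \<alpha>: "0 < \<alpha>" "\<alpha> < 1" and k: "1 \<le> k"
    and \<rho>: "\<rho> = \<alpha> / (16 * (1 + 2 * real k))"
    and t: "8 * real k / \<alpha> \<le> real t"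
    and m1: "4 * real t * 2 ^ t < m" and m2: "K \<le> \<rho> ^ 3 * m"
    and m3: "16 * K \<le> \<alpha>\<^sup>2 * \<rho>\<^sup>2 * m" and m4: "16 * real k \<le> \<alpha> * m"
  shows "contains_ham_cycle_power k V E"
proof -
  define N where "N = real (card I)"
  define n where "n = real (card V)"
  have N6: "6 \<le> N" using I6 by (simp add: N_def)
  have N0: "0 < N" using N6 by simp
  have n: "n = m * N" using m N0 by (simp add: n_def N_def)
  have m0: "0 < m" using m1 by (smt (verit) mult_nonneg_nonneg of_nat_0_le_iff zero_le_power)
  have n0: "0 < n" using n m0 N0 by simp
  have k1: "1 \<le> real k" using k by simp
  have \<rho>0: "0 < \<rho>" using \<alpha> by (simp add: \<rho>)
  have \<rho>eq: "16 * \<rho> * (1 + 2 * real k) = \<alpha>" unfolding \<rho> by (simp add: field_simps)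
  have \<rho>s: "48 * \<rho> \<le> 1"
  proof -
    have "16 * \<rho> * 3 \<le> 16 * \<rho> * (1 + 2 * real k)" using \<rho>0 k1 by (intro mult_left_mono) auto
    then show ?thesis using \<rho>eq \<alpha> by linarith
  qed
  have finA: "finite (A p)" if "p \<in> I" for p using AV[OF that] finV finite_subset by blast
  \<comment> \<open>The expected number of neighbours of \<open>u\<close> in a cell is at least
    \<open>\<alpha> * m\<close>, and \<open>bad\<close> means less than half of it. Regular cells
    have at least \<open>m / 2\<close> vertices, so the cutoff \<open>m / 4\<close> in
    \<open>out\<close> leaves \<open>m / 4\<close> good vertices in a usable pair.
    \<open>bad1\<close> collects cells of irregular size, \<open>bad2\<close> cells with too many
    unusable partners.\<close>
  define bad where "bad u q \<longleftrightarrow> card (Nb u \<inter> A q) < \<alpha> * m / 2" for u q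
  define bc where "bc p q = card {u \<in> A p. bad u q}" for p q
  define out where "out p = card {q \<in> I. m / 4 < bc p q}" for p
  define bad1 where "bad1 = {q \<in> I. \<rho> * m < \<bar>card (A q) - m\<bar>}"
  define bad2 where "bad2 = {p \<in> I. \<rho> * N < out p}"
  \<comment> \<open>Chebyshev over the cells; \<open>m2\<close> is the condition that turns
    \<open>K * n\<close> into \<open>(\<rho> * m)\<^sup>2\<close> times
    \<open>\<rho> * N\<close>.\<close>
  have bad1: "card bad1 \<le> \<rho> * N"
  proof -
    have "(\<rho> * m)\<^sup>2 * card bad1 \<le> (\<Sum>q\<in>I. (card (A q) - m)\<^sup>2)"
      unfolding bad1_def
    proof (rule card_level_set_le[OF finI])
      fix q assume "\<rho> * m < \<bar>card (A q) - m\<bar>"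
      then have "(\<rho> * m)\<^sup>2 \<le> \<bar>card (A q) - m\<bar>\<^sup>2" using \<rho>0 m0 by (intro power_mono) auto
      then show "(\<rho> * m)\<^sup>2 \<le> (card (A q) - m)\<^sup>2" by simp
    qed simp
    also have "\<dots> \<le> K * n" using dev by (simp add: n_def)
    also have "\<dots> \<le> (\<rho> ^ 3 * m) * n" using m2 n0 by (intro mult_right_mono) auto
    also have "\<dots> = (\<rho> * m)\<^sup>2 * (\<rho> * N)" by (simp add: n power2_eq_square power3_eq_cube)
    finally show ?thesis using \<rho>0 m0 by (simp add: mult_le_cancel_left_pos)
  qed
  \<comment> \<open>Each bad pair contributes at least \<open>(\<alpha> * m / 2)\<^sup>2\<close> to
    the sum in \<open>degdev\<close>, since its count is below the mean by at least
    \<open>\<alpha> * m / 2\<close>.\<close>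
  have sum_bad: "\<alpha>\<^sup>2 * (\<Sum>q\<in>I. real (card {u \<in> V. bad u q})) \<le> 4 * K * N\<^sup>2"
  proof -
    have "(\<alpha> * m / 2)\<^sup>2 * (\<Sum>q\<in>I. real (card {u \<in> V. bad u q}))
        = (\<Sum>q\<in>I. (\<alpha> * m / 2)\<^sup>2 * real (card {u \<in> V. bad u q}))" by (simp add: sum_distrib_left)
    also have "\<dots> \<le> (\<Sum>q\<in>I. \<Sum>u\<in>V. (card (Nb u \<inter> A q) - card (Nb u) / card I)\<^sup>2)"
    proof (intro sum_mono card_level_set_le[OF finV])
      fix q u assume u: "u \<in> V" "bad u q"
      have "\<alpha> * m \<le> card (Nb u) / card I"
        using Nb(3)[OF u(1)] N0 by (simp add: m N_def divide_right_mono)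
      then have "\<alpha> * m / 2 \<le> card (Nb u) / card I - card (Nb u \<inter> A q)" using u(2) unfolding bad_def by linarith
      then have "(\<alpha> * m / 2)\<^sup>2 \<le> (card (Nb u) / card I - card (Nb u \<inter> A q))\<^sup>2"
        using \<alpha> m0 by (intro power_mono) auto
      then show "(\<alpha> * m / 2)\<^sup>2 \<le> (card (Nb u \<inter> A q) - card (Nb u) / card I)\<^sup>2"
        by (simp add: power2_commute)
    qed simp
    also have "\<dots> = (\<Sum>u\<in>V. \<Sum>q\<in>I. (card (Nb u \<inter> A q) - card (Nb u) / card I)\<^sup>2)" by (rule sum.swap)
    also have "\<dots> \<le> K * n\<^sup>2" using degdev by (simp add: n_def)
    finally have "m\<^sup>2 * (\<alpha>\<^sup>2 * (\<Sum>q\<in>I. real (card {u \<in> V. bad u q}))) \<le> m\<^sup>2 * (4 * K * N\<^sup>2)"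
      by (simp add: n power_mult_distrib power_divide field_simps)
    then show ?thesis using m0 by (simp add: mult_le_cancel_left_pos)
  qed
  have sum_bc: "(\<Sum>p\<in>I. \<Sum>q\<in>I. real (bc p q)) \<le> (\<Sum>q\<in>I. real (card {u \<in> V. bad u q}))"
  proof -
    have "(\<Sum>p\<in>I. bc p q) \<le> card {u \<in> V. bad u q}" for q
    proof -
      have "(\<Sum>p\<in>I. bc p q) = card (\<Union>p\<in>I. {u \<in> A p. bad u q})"
        unfolding bc_def using finI finA disj by (subst card_UN_disjoint) (simp_all, blast)
      also have "\<dots> \<le> card {u \<in> V. bad u q}" using finV AV by (intro card_mono) auto
      finally show ?thesis .
    qed
    then have "(\<Sum>p\<in>I. real (bc p q)) \<le> real (card {u \<in> V. bad u q})" for q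
      by (metis of_nat_le_iff of_nat_sum)
    then show ?thesis by (subst sum.swap) (intro sum_mono)
  qed
  \<comment> \<open>Markov twice: a cell in \<open>bad2\<close> has more than
    \<open>\<rho> * N\<close> partners with more than \<open>m / 4\<close> bad vertices each, and
    the total number of bad pairs is bounded by \<open>sum_bad\<close>. Condition \<open>m3\<close>
    is tuned to this.\<close>
  have bad2: "card bad2 \<le> \<rho> * N"
  proof -
    have "\<rho> * N * card bad2 \<le> (\<Sum>p\<in>I. real (out p))"
      unfolding bad2_def by (rule card_level_set_le[OF finI]) auto
    then have "m / 4 * (\<rho> * N * card bad2) \<le> m / 4 * (\<Sum>p\<in>I. real (out p))"
      using m0 by (intro mult_left_mono) auto
    also have "\<dots> = (\<Sum>p\<in>I. m / 4 * real (out p))" by (simp add: sum_distrib_left)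
    also have "\<dots> \<le> (\<Sum>p\<in>I. \<Sum>q\<in>I. real (bc p q))"
      unfolding out_def by (intro sum_mono card_level_set_le[OF finI]) auto
    finally have "m / 4 * (\<rho> * N * card bad2) \<le> (\<Sum>q\<in>I. real (card {u \<in> V. bad u q}))" using sum_bc by linarith
    then have "\<alpha>\<^sup>2 * (m / 4 * (\<rho> * N * card bad2)) \<le> \<alpha>\<^sup>2 * (\<Sum>q\<in>I. real (card {u \<in> V. bad u q}))"
      by (intro mult_left_mono) auto
    also have "\<dots> \<le> 4 * K * N\<^sup>2" by (rule sum_bad)
    also have "\<dots> \<le> (\<alpha>\<^sup>2 * \<rho>\<^sup>2 * m / 4) * N\<^sup>2" using m3 by (intro mult_right_mono) auto
    finally have "(\<alpha>\<^sup>2 * m * \<rho> * N / 4) * card bad2 \<le> (\<alpha>\<^sup>2 * m * \<rho> * N / 4) * (\<rho> * N)"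
      by (simp add: power2_eq_square field_simps)
    then show ?thesis using \<alpha> m0 \<rho>0 N0 by (simp add: mult_le_cancel_left_pos)
  qed
  define R where "R = I - bad1 - bad2"
  have finR: "finite R" and RI: "R \<subseteq> I" using finI by (auto simp: R_def)
  have cR: "(1 - 2 * \<rho>) * N \<le> card R"
  proof -
    have "I \<subseteq> R \<union> (bad1 \<union> bad2)" by (auto simp: R_def)
    then have "card I \<le> card (R \<union> (bad1 \<union> bad2))" using finI by (intro card_mono) (auto simp: R_def bad1_def bad2_def)
    also have "\<dots> \<le> card R + (card bad1 + card bad2)" by (meson add_left_mono card_Un_le le_trans)
    finally have "N \<le> real (card R) + (real (card bad1) + real (card bad2))" unfolding N_def by linarith
    then show ?thesis using bad1 bad2 by (simp add: algebra_simps)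
  qed
  have Rsize: "(1 - \<rho>) * m \<le> card (A p)" "card (A p) \<le> 2 * m" if "p \<in> R" for p
  proof -
    have a: "\<bar>card (A p) - m\<bar> \<le> \<rho> * m" using that by (auto simp: R_def bad1_def)
    have "\<rho> * m \<le> 1 * m" using \<rho>s \<rho>0 m0 by (intro mult_right_mono) auto
    then show "(1 - \<rho>) * m \<le> card (A p)" "card (A p) \<le> 2 * m" using a by (auto simp: algebra_simps)
  qed
  have half: "m / 2 \<le> (1 - \<rho>) * m"
  proof -
    have "(1/2) * m \<le> (1 - \<rho>) * m" using \<rho>s \<rho>0 m0 by (intro mult_right_mono) auto
    then show ?thesis by simp
  qed
  \<comment> \<open>The relation is directed: it concerns the degrees of vertices of
    \<open>p\<close> into \<open>q\<close>.\<close>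
  define rel where "rel p q \<longleftrightarrow> p \<noteq> q \<and> bc p q \<le> m / 4" for p q
  define b where "b = nat \<lfloor>\<rho> * N\<rfloor>"
  have bN: "real b \<le> \<rho> * N" using \<rho>0 N0 by (simp add: b_def)
  obtain ps where ps: "distinct ps" "set ps \<subseteq> R" "2 \<le> length ps" "card R \<le> length ps + b"
    "\<And>i. Suc i < length ps \<Longrightarrow> rel (ps ! i) (ps ! Suc i)" "rel (last ps) (hd ps)"
  proof (rule long_cycle[OF finR, of rel b])
    fix p assume p: "p \<in> R"
    have "real (out p) \<le> \<rho> * N" using p RI by (auto simp: R_def bad2_def)
    then have "out p \<le> b" unfolding b_def by (rule le_nat_floor)
    moreover have "card {q \<in> R. q \<noteq> p \<and> \<not> rel p q} \<le> out p"
      unfolding out_def using finI RI by (intro card_mono) (auto simp: rel_def)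
    ultimately show "card {q \<in> R. q \<noteq> p \<and> \<not> rel p q} \<le> b" by simp
  next
    \<comment> \<open>After discarding \<open>2 * \<rho> * N\<close> cells and subtracting
      \<open>b\<close>, at least \<open>N / 3 \<ge> 2\<close> remain; this is the origin of the
      bound \<open>6 \<le> card I\<close>.\<close>
    have "(1/3) * N \<le> (1 - 3 * \<rho>) * N" using \<rho>s \<rho>0 N0 by (intro mult_right_mono) auto
    then have "real b + 2 \<le> card R" using cR bN N6 by (simp add: algebra_simps)
    then show "b + 2 \<le> card R" by linarith
  qed blast
  let ?D = "set ps" and ?L = "length ps"
  have DI: "p \<in> I" "p \<in> R" if "p \<in> ?D" for p using that ps(2) RI by auto
  have lenD: "(1 - 3 * \<rho>) * N \<le> ?L"
  proof -
    have "real (card R) \<le> ?L + real b" using ps(4) by linarith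
    then show ?thesis using cR bN by (simp add: algebra_simps)
  qed
  have LI: "real ?L \<le> N"
    using ps(1,2) RI finI unfolding N_def by (metis card_mono distinct_card of_nat_mono subset_trans)
  \<comment> \<open>The second side has size \<open>2 * k\<close> rather than \<open>k\<close> so
    that \<open>k\<close> vertices survive when the exit set of the next cell is removed. The
    density \<open>\<alpha> / 4\<close> used below compares \<open>\<alpha> * m / 2\<close>
    neighbours with a cell of size at most \<open>2 * m\<close>.\<close>
  have link: "\<exists>S. S \<subseteq> A p \<and> card S = k \<and> 2 * k \<le> card {b \<in> A q. \<forall>u\<in>S. b \<in> Nb u}"
    if p: "p \<in> R" and q: "q \<in> R" and r: "rel p q" for p q
  proof -
    have fA: "finite (A p)" "finite (A q)" using p q RI finA by auto
    let ?G = "{u \<in> A p. \<not> bad u q}"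
    have "card (A p) = card ?G + bc p q"
      unfolding bc_def using fA by (subst card_Un_disjoint[symmetric]) (auto intro!: arg_cong[where f = card])
    then have "m / 4 \<le> card ?G" using Rsize(1)[OF p] half r by (simp add: rel_def)
    moreover have "real t * 1 \<le> real t * 2 ^ t" by (intro mult_left_mono) auto
    ultimately have "real t \<le> card ?G" using m1 by linarith
    then have "t \<le> card ?G" by simp
    then obtain S0 where S0: "S0 \<subseteq> ?G" "card S0 = t" "finite S0"
      by (rule obtain_subset_with_card_n)
    obtain S where "S \<subseteq> S0" "card S = k" "2 * k \<le> card {b \<in> A q. \<forall>u\<in>S. b \<in> Nb u}"
    proof (rule common_neighbours[of S0 "A q" t "\<alpha> / 4" Nb k "2 * k"])
      fix u assume "u \<in> S0"
      then have "\<alpha> * m / 2 \<le> card (Nb u \<inter> A q)" using S0 by (auto simp: bad_def)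
      moreover have "\<alpha> / 4 * card (A q) \<le> \<alpha> / 4 * (2 * m)" using Rsize(2)[OF q] \<alpha> by (intro mult_left_mono) auto
      ultimately show "\<alpha> / 4 * card (A q) \<le> card (Nb u \<inter> A q)" by simp
    next
      show "2 * real k \<le> real t * (\<alpha> / 4)" using t \<alpha> by (simp add: field_simps)
      have "2 * (real t * 2 ^ t) < card (A q)" using m1 Rsize(1)[OF q] half by linarith
      then have "real (2 * (t * 2 ^ t)) < real (card (A q))" by simp
      then have "2 * (t * 2 ^ t) < card (A q)" by linarith
      then have "k * (2 * (t * 2 ^ t)) < k * card (A q)" using k by simp
      then show "2 * k * t * 2 ^ t < k * card (A q)" by (simp add: mult_ac)
    qed (use S0 fA in auto)
    then show ?thesis using S0 by blast
  qed
  define nx where "nx i = ps ! (Suc i mod ?L)" for i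
  define prv where "prv i = (if i = 0 then ?L - 1 else i - 1)" for i
  define idx where "idx p = (SOME i. i < ?L \<and> ps ! i = p)" for p
  have idx: "idx p < ?L" "ps ! idx p = p" if "p \<in> ?D" for p
    using someI_ex[of "\<lambda>i. i < ?L \<and> ps ! i = p"] that by (auto simp: idx_def in_set_conv_nth)
  have idx_nth: "idx (ps ! i) = i" if "i < ?L" for i
    using idx[of "ps ! i"] that ps(1) by (simp add: nth_eq_iff_index_eq)
  have nxD: "nx i \<in> ?D" for i unfolding nx_def using ps(3) by (intro nth_mem mod_less_divisor) auto
  have prv: "prv i < ?L" "nx (prv i) = ps ! i" if "i < ?L" for i
    using that ps(3) by (auto simp: prv_def nx_def)
  have rel_nx: "rel (ps ! i) (nx i)" if "i < ?L" for i
  proof (cases "Suc i < ?L")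
    case True then show ?thesis using ps(5) by (simp add: nx_def)
  next
    case False
    then have "i = ?L - 1" "Suc i = ?L" using that by auto
    moreover have "ps \<noteq> []" using ps(3) by auto
    ultimately show ?thesis using ps(6) by (simp add: nx_def last_conv_nth hd_conv_nth)
  qed
  have exS: "\<exists>S. S \<subseteq> A (ps ! i) \<and> card S = k \<and> 2 * k \<le> card {b \<in> A (nx i). \<forall>u\<in>S. b \<in> Nb u}" if "i < ?L" for i
    using link[OF _ _ rel_nx[OF that]] DI nxD that by auto
  define S' where "S' i = (SOME S. S \<subseteq> A (ps ! i) \<and> card S = k \<and>
      2 * k \<le> card {b \<in> A (nx i). \<forall>u\<in>S. b \<in> Nb u})" for i
  have S': "S' i \<subseteq> A (ps ! i) \<and> card (S' i) = k \<and>
      2 * k \<le> card {b \<in> A (nx i). \<forall>u\<in>S' i. b \<in> Nb u}" if "i < ?L" for i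
    unfolding S'_def by (rule someI_ex[OF exS[OF that]])
  define S where "S p = S' (idx p)" for p
  have S: "S p \<subseteq> A p" "card (S p) = k" "finite (S p)" if "p \<in> ?D" for p
    using S'[OF idx(1)[OF that]] idx(2)[OF that] finA[OF DI(1)[OF that]]
    by (auto simp: S_def intro: finite_subset)
  \<comment> \<open>All exit sets are fixed first; the entry set of the next cell is then taken from
    the \<open>2 * k\<close> common neighbours while avoiding the \<open>k\<close> vertices of its
    exit set.\<close>
  have exT: "\<exists>T. T \<subseteq> {b \<in> A (nx i). \<forall>u\<in>S' i. b \<in> Nb u} - S (nx i) \<and> card T = k" if "i < ?L" for i
  proof -
    have "2 * k - k \<le> card ({b \<in> A (nx i). \<forall>u\<in>S' i. b \<in> Nb u} - S (nx i))"
      using S'[OF that] S(2,3)[OF nxD[of i]] diff_card_le_card_Diff[of "S (nx i)" "{b \<in> A (nx i). \<forall>u\<in>S' i. b \<in> Nb u}"]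
      by linarith
    then have "k \<le> card ({b \<in> A (nx i). \<forall>u\<in>S' i. b \<in> Nb u} - S (nx i))" by simp
    then obtain T where "T \<subseteq> {b \<in> A (nx i). \<forall>u\<in>S' i. b \<in> Nb u} - S (nx i)" "card T = k"
      by (rule obtain_subset_with_card_n)
    then show ?thesis by blast
  qed
  define T' where "T' i = (SOME T. T \<subseteq> {b \<in> A (nx i). \<forall>u\<in>S' i. b \<in> Nb u} - S (nx i) \<and> card T = k)" for i
  have T': "T' i \<subseteq> {b \<in> A (nx i). \<forall>u\<in>S' i. b \<in> Nb u} - S (nx i) \<and> card (T' i) = k" if "i < ?L" for i
    unfolding T'_def by (rule someI_ex[OF exT[OF that]])
  define T where "T p = T' (prv (idx p))" for p
  have T: "T p \<subseteq> A p - S p" "card (T p) = k" "finite (T p)" if "p \<in> ?D" for p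
  proof -
    have "nx (prv (idx p)) = p" using prv(2)[OF idx(1)[OF that]] idx(2)[OF that] by simp
    then show "T p \<subseteq> A p - S p" "card (T p) = k"
      using T'[OF prv(1)[OF idx(1)[OF that]]] by (auto simp: T_def)
    then show "finite (T p)" using finA[OF DI(1)[OF that]] by (meson Diff_subset finite_subset)
  qed
  have join: "{a, b} \<in> E" if i: "i < ?L" and a: "a \<in> S' i" and b: "b \<in> T' i" for i a b
  proof -
    have "a \<in> V" using a S'[OF i] AV[OF DI(1)[of "ps ! i"]] i by auto
    moreover have "b \<in> Nb a" using T'[OF i] a b by auto
    ultimately show ?thesis by (rule Nb(2))
  qed
  define U where "U = V - (\<Union>p\<in>?D. A p)"
  have VU: "V = U \<union> (\<Union>p\<in>?D. A p)" using AV DI(1) by (auto simp: U_def)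
  have finU: "finite U" using finV by (simp add: U_def)
  \<comment> \<open>The cycle keeps at least \<open>(1 - 3 * \<rho>) * N\<close> cells of size at
    least \<open>(1 - \<rho>) * m\<close>, and
    \<open>(1 - 3 * \<rho>) * (1 - \<rho>) \<ge> 1 - 4 * \<rho>\<close>.\<close>
  have cU: "card U \<le> 4 * \<rho> * n"
  proof -
    have c1: "card (\<Union>p\<in>?D. A p) = (\<Sum>p\<in>?D. card (A p))"
      using finA DI(1) disj by (intro card_UN_disjoint) auto
    have "real ?L * ((1 - \<rho>) * m) = (\<Sum>p\<in>?D. (1 - \<rho>) * m)" using ps(1) by (simp add: distinct_card)
    also have "\<dots> \<le> (\<Sum>p\<in>?D. real (card (A p)))" using Rsize(1) DI(2) by (intro sum_mono) auto
    also have "\<dots> = card (\<Union>p\<in>?D. A p)" using c1 by simp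
    finally have c2: "real ?L * ((1 - \<rho>) * m) \<le> card (\<Union>p\<in>?D. A p)" .
    have "(1 - 4 * \<rho>) * n \<le> (1 - 3 * \<rho>) * N * ((1 - \<rho>) * m)"
    proof -
      have "(1 - 4 * \<rho>) * (m * N) \<le> ((1 - 3 * \<rho>) * (1 - \<rho>)) * (m * N)"
        using \<rho>0 m0 N0 by (intro mult_right_mono) (auto simp: algebra_simps)
      then show ?thesis by (simp add: n mult_ac)
    qed
    also have "\<dots> \<le> real ?L * ((1 - \<rho>) * m)" using lenD m0 half by (intro mult_right_mono) auto
    finally have "(1 - 4 * \<rho>) * n \<le> card (\<Union>p\<in>?D. A p)" using c2 by linarith
    moreover have "card V = card U + card (\<Union>p\<in>?D. A p)"
      using AV DI(1) finV card_Diff_subset[of "\<Union>p\<in>?D. A p" V] card_mono[of V "\<Union>p\<in>?D. A p"]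
      by (simp add: U_def UN_subset_iff finA)
    ultimately show ?thesis by (simp add: n_def algebra_simps)
  qed
  define F where "F p = A p - S p - T p" for p
  have "\<exists>c g. \<forall>u\<in>U. c u \<in> ?D \<and> g u \<subseteq> F (c u) \<inter> Nb u \<and> card (g u) = 2 * k \<and>
            (\<forall>v\<in>U. u \<noteq> v \<longrightarrow> g u \<inter> g v = {})"
  proof (rule disjoint_absorbers[OF finU, of _ _ "card U"])
    show "finite (F p)" if "p \<in> ?D" for p using finA[OF DI(1)[OF that]] by (simp add: F_def)
    fix u assume "u \<in> U"
    then have u: "u \<in> V" by (simp add: U_def)
    let ?X = "\<Union>p\<in>?D. S p \<union> T p"
    have fX: "finite ?X" using S(3) T(3) by auto
    have "card ?X \<le> (\<Sum>p\<in>?D. card (S p \<union> T p))" by (rule card_UN_le) simp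
    also have "\<dots> \<le> (\<Sum>p\<in>?D. 2 * k)"
    proof (rule sum_mono)
      fix p assume "p \<in> ?D"
      then show "card (S p \<union> T p) \<le> 2 * k" using card_Un_le[of "S p" "T p"] S(2) T(2) by auto
    qed
    also have "\<dots> = 2 * k * ?L" using ps(1) by (simp add: distinct_card)
    finally have cX: "card ?X \<le> 2 * k * ?L" .
    have "Nb u \<subseteq> (Nb u \<inter> (\<Union>p\<in>?D. F p)) \<union> (U \<union> ?X)"
      using Nb(1)[OF u] by (auto simp: F_def U_def)
    then have "card (Nb u) \<le> card ((Nb u \<inter> (\<Union>p\<in>?D. F p)) \<union> (U \<union> ?X))"
      using finV Nb(1)[OF u] finU fX by (intro card_mono) (auto intro: finite_subset)
    also have "\<dots> \<le> card (Nb u \<inter> (\<Union>p\<in>?D. F p)) + (card U + card ?X)"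
      by (meson add_left_mono card_Un_le le_trans)
    also have "\<dots> \<le> card (Nb u \<inter> (\<Union>p\<in>?D. F p)) + (card U + 2 * k * ?L)" using cX by simp
    finally have c1: "real (card (Nb u)) \<le> card (Nb u \<inter> (\<Union>p\<in>?D. F p)) + (card U + 2 * k * ?L)"
      by (metis of_nat_le_iff of_nat_add)
    have c2: "real k * ?L \<le> \<alpha> * n / 16"
    proof -
      have "16 * real k * ?L \<le> 16 * real k * N" using LI by (intro mult_left_mono) auto
      also have "\<dots> \<le> \<alpha> * m * N" using m4 N0 by (intro mult_right_mono) auto
      finally show ?thesis by (simp add: n)
    qed
    have c3: "(1 + 2 * real k) * card U \<le> \<alpha> * n / 4"
    proof -
      have "(1 + 2 * real k) * card U \<le> (1 + 2 * real k) * (4 * \<rho> * n)" using cU by (intro mult_left_mono) auto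
      also have "\<dots> = (16 * \<rho> * (1 + 2 * real k)) * n / 4" by (simp add: algebra_simps)
      finally show ?thesis unfolding \<rho>eq .
    qed
    have c4: "\<alpha> * n \<le> card (Nb u)" using Nb(3)[OF u] by (simp add: n_def)
    have "0 \<le> \<alpha> * n" using \<alpha> n0 by simp
    then have "2 * real k * card U + 2 * (real k * ?L) \<le> card (Nb u \<inter> (\<Union>p\<in>?D. F p))"
      using c1 c2 c3 c4 by (simp add: algebra_simps)
    then have "real (2 * k * card U + 2 * k * card ?D) \<le> card (Nb u \<inter> (\<Union>p\<in>?D. F p))"
      using ps(1) by (simp add: distinct_card)
    then show "2 * k * card U + 2 * k * card ?D \<le> card (Nb u \<inter> (\<Union>p\<in>?D. F p))" by linarith
  qed (use k in auto)
  then obtain c g where cg: "\<And>u. u \<in> U \<Longrightarrow> c u \<in> ?D \<and> g u \<subseteq> F (c u) \<inter> Nb u \<and> card (g u) = 2 * k \<and>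
            (\<forall>v\<in>U. u \<noteq> v \<longrightarrow> g u \<inter> g v = {})" by blast
  show ?thesis unfolding VU
  proof (rule ham_cycle_power_assembly[of ps k A E S T U c g])
    show "finite (A p)" if "p \<in> ?D" for p using finA DI(1)[OF that] by blast
    show "A p \<inter> A q = {}" if "p \<in> ?D" "q \<in> ?D" "p \<noteq> q" for p q using disj DI(1) that by blast
    show "{a, b} \<in> E" if "p \<in> ?D" "a \<in> A p" "b \<in> A p" "a \<noteq> b" for p a b
      using clique DI(1) that by blast
    show "S p \<subseteq> A p \<and> card (S p) = k" "T p \<subseteq> A p \<and> card (T p) = k" "S p \<inter> T p = {}" if "p \<in> ?D" for p
      using S[OF that] T[OF that] by auto
    show "{a, b} \<in> E" if "Suc i < ?L" "a \<in> S (ps ! i)" "b \<in> T (ps ! Suc i)" for i a b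
      using join[of i a b] that by (simp add: S_def T_def idx_nth prv_def)
    show "{a, b} \<in> E" if "a \<in> S (last ps)" "b \<in> T (hd ps)" for a b
    proof -
      have ne: "ps \<noteq> []" using ps(3) by auto
      have "last ps = ps ! (?L - 1)" "hd ps = ps ! 0" "?L - 1 < ?L" "0 < ?L"
        using ne ps(3) by (auto simp: last_conv_nth hd_conv_nth)
      then show ?thesis using join[of "?L - 1" a b] that by (simp add: S_def T_def idx_nth prv_def)
    qed
    show "U \<inter> A p = {}" if "p \<in> ?D" for p using that by (auto simp: U_def)
    show "c u \<in> ?D" "g u \<subseteq> A (c u) - S (c u) - T (c u) \<and> card (g u) = 2 * k" if "u \<in> U" for u
      using cg[OF that] by (auto simp: F_def)
    show "g u \<inter> g v = {}" if "u \<in> U" "v \<in> U" "u \<noteq> v" for u v using cg[OF that(1)] that by blast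
    show "{u, a} \<in> E" if "u \<in> U" "a \<in> g u" for u a
      using cg[OF that(1)] that Nb(2)[of u a] by (auto simp: U_def)
  qed (use ps k finU in auto)
qed

section \<open>Uniform points in the cube\<close>

lemma emeasure_lborel_cbox_cart:
  fixes a b :: "real ^ 'd"
  assumes "\<And>i. a $ i \<le> b $ i"
  shows "emeasure lborel (cbox a b) = ennreal (\<Prod>i\<in>UNIV. b $ i - a $ i)"
proof -
  have "cbox a b \<noteq> {}" using assms by (auto simp: interval_ne_empty_cart)
  then have "measure lborel (cbox a b) = (\<Prod>i\<in>UNIV. b $ i - a $ i)" by (rule content_cbox_cart)
  moreover have "emeasure lborel (cbox a b) \<noteq> \<top>" using emeasure_lborel_cbox_finite[of a b] by simp
  ultimately show ?thesis by (simp add: emeasure_eq_ennreal_measure)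
qed

lemma emeasure_unit_cube: "emeasure lborel (cbox 0 1 :: (real ^ 'd) set) = 1"
  by (subst emeasure_lborel_cbox_cart) auto

abbreviation unit_cube :: "(real ^ 'd) measure" where
  "unit_cube \<equiv> uniform_measure lborel (cbox 0 1)"

lemma prob_space_unit_cube: "prob_space (unit_cube :: (real ^ 'd) measure)"
  by (intro prob_space_uniform_measure) (simp_all add: emeasure_unit_cube)

lemma emeasure_unit_cube_eq:
  fixes B :: "(real ^ 'd) set"
  assumes "B \<in> sets borel"
  shows "emeasure unit_cube B = emeasure lborel (cbox 0 1 \<inter> B)"
proof -
  have "inverse (1 :: ennreal) = 1" by (metis inverse_ennreal ennreal_1 inverse_1 zero_less_one)
  then show ?thesis
    using assms by (subst emeasure_uniform_measure) (simp_all add: emeasure_unit_cube divide_ennreal_def)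
qed

declare emeasure_uniform_measure[simp del] measure_uniform_measure[simp del]

interpretation unit_cube: prob_space "unit_cube :: (real ^ 'd) measure"
  by (rule prob_space_unit_cube)

interpretation uniform_points: product_prob_space "\<lambda>_. unit_cube :: (real ^ 'd) measure" "{1..n}" for n :: nat
  by unfold_locales

lemma prob_space_uniform_points: "prob_space (uniform_points n :: (nat \<Rightarrow> real ^ 'd) measure)"
  unfolding uniform_points_def by (intro prob_space_PiM prob_space_unit_cube)

lemma measurable_uniform_points_component:
  "i \<in> {1..n} \<Longrightarrow> (\<lambda>X. X i) \<in> borel_measurable (uniform_points n :: (nat \<Rightarrow> real ^ 'd) measure)"
  unfolding uniform_points_def
  using measurable_component_singleton[of i "{1..n}" "\<lambda>_. unit_cube :: (real ^ 'd) measure"]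
  by (simp add: measurable_def)

text \<open>Pairwise independence is the form of independence on which both the variance computation
  and the edge probability rest.\<close>

lemma prob_uniform_points_pair:
  fixes A B :: "(real ^ 'd) set"
  assumes ij: "i \<in> {1..n}" "j \<in> {1..n}" "i \<noteq> j" and AB: "A \<in> sets borel" "B \<in> sets borel"
  shows "emeasure (uniform_points n) {X \<in> space (uniform_points n). X i \<in> A \<and> X j \<in> B}
           = emeasure unit_cube A * emeasure unit_cube B"
proof -
  have "emeasure (uniform_points n) {X \<in> space (uniform_points n). \<forall>l\<in>{i, j}. X l \<in> (if l = i then A else B)}
     = (\<Prod>l\<in>{i, j}. emeasure unit_cube (if l = i then A else B))"
    unfolding uniform_points_def
    by (rule uniform_points.emeasure_PiM_Collect) (use ij AB in auto)
  then show ?thesis using ij(3) by auto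
qed

lemma prob_uniform_points_single:
  fixes A :: "(real ^ 'd) set"
  assumes "i \<in> {1..n}" "A \<in> sets borel"
  shows "emeasure (uniform_points n) {X \<in> space (uniform_points n). X i \<in> A} = emeasure unit_cube A"
  unfolding uniform_points_def
  by (rule uniform_points.emeasure_PiM_Collect_single) (use assms in auto)

text \<open>Given \<open>X i = x\<close>, the point \<open>X j\<close> must fall into the cube of
  side \<open>2 * r\<close> centred at \<open>x\<close>, which contains the Euclidean ball.\<close>

lemma prob_close_le:
  assumes ij: "i \<in> {1..n}" "j \<in> {1..n}" "i \<noteq> j" and r: "0 \<le> r"
  shows "measure (uniform_points n :: (nat \<Rightarrow> real ^ 'd) measure)
           {X \<in> space (uniform_points n). norm (X i - X j) \<le> r} \<le> (2 * r) ^ CARD('d)"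
proof -
  let ?M = "uniform_points n :: (nat \<Rightarrow> real ^ 'd) measure" and ?U = "unit_cube :: (real ^ 'd) measure"
  interpret M: prob_space ?M by (rule prob_space_uniform_points)
  have meas[measurable]: "(\<lambda>X. X i) \<in> borel_measurable ?M" "(\<lambda>X. X j) \<in> borel_measurable ?M"
    using ij by (auto intro: measurable_uniform_points_component)
  have sets_U: "sets ?U = sets borel" by simp
  have pm: "(\<lambda>X. (X i, X j)) \<in> measurable ?M (?U \<Otimes>\<^sub>M ?U)"
    by (intro measurable_Pair) (simp_all add: measurable_cong_sets[OF refl sets_U])
  \<comment> \<open>The joint law of the two points is the product measure, as the two agree on
    rectangles; Fubini then allows conditioning on the first point.\<close>
  have joint: "?U \<Otimes>\<^sub>M ?U = distr ?M (?U \<Otimes>\<^sub>M ?U) (\<lambda>X. (X i, X j))"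
  proof (rule pair_measure_eqI)
    fix A B assume AB: "A \<in> sets ?U" "B \<in> sets ?U"
    have "emeasure (distr ?M (?U \<Otimes>\<^sub>M ?U) (\<lambda>X. (X i, X j))) (A \<times> B)
        = emeasure ?M {X \<in> space ?M. X i \<in> A \<and> X j \<in> B}"
      using AB by (subst emeasure_distr[OF pm]) (auto intro!: arg_cong[where f = "emeasure ?M"])
    then show "emeasure ?U A * emeasure ?U B = emeasure (distr ?M (?U \<Otimes>\<^sub>M ?U) (\<lambda>X. (X i, X j))) (A \<times> B)"
      using prob_uniform_points_pair[OF ij, of A B] AB by simp
  qed (auto intro: unit_cube.sigma_finite_measure_axioms)
  let ?S = "{z :: (real ^ 'd) \<times> (real ^ 'd). norm (fst z - snd z) \<le> r}"
  have "?S \<in> sets (borel \<Otimes>\<^sub>M borel)"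
    unfolding borel_prod by (intro borel_closed closed_Collect_le continuous_intros)
  then have S: "?S \<in> sets (?U \<Otimes>\<^sub>M ?U)" by (simp add: sets_pair_measure_cong[OF sets_U sets_U])
  have "emeasure ?M {X \<in> space ?M. norm (X i - X j) \<le> r} = emeasure (distr ?M (?U \<Otimes>\<^sub>M ?U) (\<lambda>X. (X i, X j))) ?S"
    by (subst emeasure_distr[OF pm S]) (auto intro!: arg_cong[where f = "emeasure ?M"])
  also have "\<dots> = emeasure (?U \<Otimes>\<^sub>M ?U) ?S" using joint by simp
  also have "\<dots> = (\<integral>\<^sup>+x. emeasure ?U (Pair x -` ?S) \<partial>?U)"
    by (rule unit_cube.emeasure_pair_measure_alt[OF S])
  also have "\<dots> \<le> (\<integral>\<^sup>+x. ennreal ((2 * r) ^ CARD('d)) \<partial>?U)"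
  proof (rule nn_integral_mono)
    fix x :: "real ^ 'd"
    let ?a = "\<chi> l. x $ l - r" and ?b = "\<chi> l. x $ l + r"
    have "Pair x -` ?S \<in> sets ?U" using S by (rule sets_Pair1)
    then have "emeasure ?U (Pair x -` ?S) = emeasure lborel (cbox 0 1 \<inter> (Pair x -` ?S))"
      by (intro emeasure_unit_cube_eq) simp
    also have "\<dots> \<le> emeasure lborel (cbox ?a ?b)"
    proof (rule emeasure_mono)
      show "cbox 0 1 \<inter> (Pair x -` ?S) \<subseteq> cbox ?a ?b"
      proof
        fix y assume "y \<in> cbox 0 1 \<inter> (Pair x -` ?S)"
        then have "\<bar>(x - y) $ l\<bar> \<le> r" for l using component_le_norm_cart[of "x - y" l] by simp
        then have "\<bar>x $ l - y $ l\<bar> \<le> r" for l by simp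
        then show "y \<in> cbox ?a ?b" unfolding mem_box_cart by (auto simp: abs_le_iff algebra_simps)
      qed
    qed simp
    also have "\<dots> = ennreal ((2 * r) ^ CARD('d))"
      using r by (subst emeasure_lborel_cbox_cart) (auto simp: mult.commute)
    finally show "emeasure ?U (Pair x -` ?S) \<le> ennreal ((2 * r) ^ CARD('d))" .
  qed
  also have "\<dots> = ennreal ((2 * r) ^ CARD('d)) * emeasure ?U (space ?U)" by (rule nn_integral_const)
  also have "emeasure ?U (space ?U) = 1" by (rule unit_cube.emeasure_space_1)
  finally have "ennreal (measure ?M {X \<in> space ?M. norm (X i - X j) \<le> r}) \<le> ennreal ((2 * r) ^ CARD('d))"
    by (simp add: M.emeasure_eq_measure)
  then show ?thesis using r by (simp add: ennreal_le_iff)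
qed

section \<open>Second moments of cell counts\<close>

text \<open>The covariances vanish by pairwise independence, so only the diagonal terms
  \<open>p - p\<^sup>2\<close> of the expanded square remain.\<close>

lemma (in prob_space) second_moment_pairwise_indep:
  fixes p :: real
  assumes fin: "finite S" and B: "\<And>u. u \<in> S \<Longrightarrow> B u \<in> events"
    and p: "\<And>u. u \<in> S \<Longrightarrow> prob (B u) = p"
    and p2: "\<And>u v. u \<in> S \<Longrightarrow> v \<in> S \<Longrightarrow> u \<noteq> v \<Longrightarrow> prob (B u \<inter> B v) = p\<^sup>2"
  shows "integrable M (\<lambda>x. ((\<Sum>u\<in>S. indicat_real (B u) x) - card S * p)\<^sup>2)"
    and "expectation (\<lambda>x. ((\<Sum>u\<in>S. indicat_real (B u) x) - card S * p)\<^sup>2) = card S * (p - p\<^sup>2)"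
proof -
  \<comment> \<open>\<open>h u v\<close> is the product of two centred indicators, written out so
    that only indicators of events have to be integrated.\<close>
  define h where "h u v x = indicat_real (B u \<inter> B v) x - p * indicat_real (B u) x - p * indicat_real (B v) x + p\<^sup>2"
    for u v x
  have eq: "((\<Sum>u\<in>S. indicat_real (B u) x) - card S * p)\<^sup>2 = (\<Sum>u\<in>S. \<Sum>v\<in>S. h u v x)" for x
  proof -
    have "(\<Sum>u\<in>S. indicat_real (B u) x) - card S * p = (\<Sum>u\<in>S. indicat_real (B u) x - p)"
      by (simp add: sum_subtractf)
    then have "((\<Sum>u\<in>S. indicat_real (B u) x) - card S * p)\<^sup>2
       = (\<Sum>u\<in>S. \<Sum>v\<in>S. (indicat_real (B u) x - p) * (indicat_real (B v) x - p))"
      by (simp add: power2_eq_square sum_product)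
    also have "\<dots> = (\<Sum>u\<in>S. \<Sum>v\<in>S. h u v x)"
      by (intro sum.cong refl) (simp add: h_def indicator_inter_arith algebra_simps power2_eq_square)
    finally show ?thesis .
  qed
  have int1: "integrable M (indicat_real A)" if "A \<in> events" for A
    using that by (simp add: integrable_indicator_iff less_top[symmetric])
  have inth: "integrable M (h u v)" if "u \<in> S" "v \<in> S" for u v
    unfolding h_def using B that by (intro Bochner_Integration.integrable_add
      Bochner_Integration.integrable_diff integrable_mult_right int1) auto
  have Eh: "expectation (h u v) = (if u = v then p - p\<^sup>2 else 0)" if uv: "u \<in> S" "v \<in> S" for u v
  proof -
    have "expectation (h u v) = prob (B u \<inter> B v) - p * prob (B u) - p * prob (B v) + p\<^sup>2"
      unfolding h_def using B uv sets.sets_into_space[of "B u" M] sets.sets_into_space[of "B v" M]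
      by (subst Bochner_Integration.integral_add Bochner_Integration.integral_diff;
          (intro Bochner_Integration.integrable_diff integrable_mult_right int1)?; simp add: int1 prob_space Int_absorb2 inf_commute)+
    then show ?thesis using p[OF uv(1)] p[OF uv(2)] p2[OF uv] by (simp add: power2_eq_square)
  qed
  show "integrable M (\<lambda>x. ((\<Sum>u\<in>S. indicat_real (B u) x) - card S * p)\<^sup>2)"
    unfolding eq using inth by auto
  have "expectation (\<lambda>x. \<Sum>u\<in>S. \<Sum>v\<in>S. h u v x) = (\<Sum>u\<in>S. \<Sum>v\<in>S. expectation (h u v))"
    using inth by (simp add: Bochner_Integration.integral_sum)
  also have "\<dots> = (\<Sum>u\<in>S. \<Sum>v\<in>S. if u = v then p - p\<^sup>2 else 0)" using Eh by (intro sum.cong) auto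
  also have "\<dots> = card S * (p - p\<^sup>2)" using fin by (simp add: sum.delta)
  finally show "expectation (\<lambda>x. ((\<Sum>u\<in>S. indicat_real (B u) x) - card S * p)\<^sup>2) = card S * (p - p\<^sup>2)"
    unfolding eq .
qed

text \<open>Applied with \<open>S\<close> the whole vertex set for cell sizes, and with
  \<open>S\<close> a neighbourhood in \<open>H\<close> for degrees into a cell.\<close>

lemma second_moment_cell_count:
  fixes Q :: "(real ^ 'd) set" and p :: real
  assumes S: "S \<subseteq> {1..n}" and Q: "Q \<in> sets borel" and p: "measure unit_cube Q = p"
  shows "integrable (uniform_points n) (\<lambda>X. (real (card {u \<in> S. X u \<in> Q}) - card S * p)\<^sup>2)"
    and "(\<integral>X. (real (card {u \<in> S. X u \<in> Q}) - card S * p)\<^sup>2 \<partial>uniform_points n) \<le> card S * p"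
proof -
  let ?M = "uniform_points n :: (nat \<Rightarrow> real ^ 'd) measure"
  interpret M: prob_space ?M by (rule prob_space_uniform_points)
  define B where "B u = {X \<in> space ?M. X u \<in> Q}" for u
  have fin: "finite S" using S finite_subset by blast
  have Bm: "B u \<in> M.events" if "u \<in> S" for u
    unfolding B_def using S Q that by (intro measurable_sets_Collect[OF measurable_uniform_points_component]) (auto simp: subset_iff)
  have p1: "M.prob (B u) = p" if "u \<in> S" for u
    using prob_uniform_points_single[of u n Q] S Q that p unfolding B_def by (auto simp: measure_def)
  have p2: "M.prob (B u \<inter> B v) = p\<^sup>2" if "u \<in> S" "v \<in> S" "u \<noteq> v" for u v
  proof -
    have "B u \<inter> B v = {X \<in> space ?M. X u \<in> Q \<and> X v \<in> Q}" by (auto simp: B_def)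
    then have "emeasure ?M (B u \<inter> B v) = emeasure unit_cube Q * emeasure unit_cube Q"
      using prob_uniform_points_pair[of u n v Q Q] Q that subsetD[OF S] by simp
    then show ?thesis using p by (simp add: measure_def enn2real_mult power2_eq_square)
  qed
  have card_eq: "real (card {u \<in> S. X u \<in> Q}) = (\<Sum>u\<in>S. indicat_real (B u) X)" if "X \<in> space ?M" for X
  proof -
    have "(\<Sum>u\<in>S. indicat_real (B u) X) = (\<Sum>u\<in>S. if X u \<in> Q then 1 else 0)"
      using that by (intro sum.cong) (auto simp: B_def)
    also have "\<dots> = real (card {u \<in> S. X u \<in> Q})" using fin by (simp add: sum.If_cases Int_def)
    finally show ?thesis by simp
  qed
  note sm = M.second_moment_pairwise_indep[OF fin Bm p1 p2]
  show "integrable ?M (\<lambda>X. (real (card {u \<in> S. X u \<in> Q}) - card S * p)\<^sup>2)"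
    using sm(1) by (subst Bochner_Integration.integrable_cong[OF refl]) (auto simp: card_eq)
  have "(\<integral>X. (real (card {u \<in> S. X u \<in> Q}) - card S * p)\<^sup>2 \<partial>?M) = card S * (p - p\<^sup>2)"
    using sm(2) by (subst Bochner_Integration.integral_cong[OF refl]) (auto simp: card_eq)
  also have "\<dots> \<le> card S * p" by (intro mult_left_mono) auto
  finally show "(\<integral>X. (real (card {u \<in> S. X u \<in> Q}) - card S * p)\<^sup>2 \<partial>?M) \<le> card S * p" .
qed

text \<open>Counts in different cells are dependent, but linearity of expectation is enough: the two
  sums have means at most \<open>n\<close> and \<open>n\<^sup>2\<close>. Markov's inequality gives
  failure probability at most \<open>1 / K\<close> for each, and a union bound adds them.\<close>

lemma prob_regular_cells:
  fixes Q :: "'c \<Rightarrow> (real ^ 'd) set" and K :: real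
  assumes n: "1 \<le> n" and I: "finite I" "I \<noteq> {}" and Q: "\<And>q. q \<in> I \<Longrightarrow> Q q \<in> sets borel"
    "\<And>q. q \<in> I \<Longrightarrow> measure unit_cube (Q q) = 1 / card I"
    and Nb: "\<And>u. u \<in> {1..n} \<Longrightarrow> Nb u \<subseteq> {1..n}" and K: "0 < K"
    and Ev: "E \<in> sets (uniform_points n)"
    and good: "\<And>X. X \<in> space (uniform_points n) \<Longrightarrow>
      (\<Sum>q\<in>I. (real (card {u \<in> {1..n}. X u \<in> Q q}) - n / card I)\<^sup>2) \<le> K * n \<Longrightarrow>
      (\<Sum>u\<in>{1..n}. \<Sum>q\<in>I. (real (card {v \<in> Nb u. X v \<in> Q q}) - card (Nb u) / card I)\<^sup>2) \<le> K * (real n)\<^sup>2 \<Longrightarrow>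
      X \<in> E"
  shows "1 - 2 / K \<le> measure (uniform_points n) E"
proof -
  let ?M = "uniform_points n :: (nat \<Rightarrow> real ^ 'd) measure"
  interpret M: prob_space ?M by (rule prob_space_uniform_points)
  define dev where "dev S q X = (real (card {u \<in> S. X u \<in> Q q}) - card S / card I)\<^sup>2" for S q and X :: "nat \<Rightarrow> real ^ 'd"
  have dev: "integrable ?M (dev S q)" "(\<integral>X. dev S q X \<partial>?M) \<le> card S / card I" if "S \<subseteq> {1..n}" "q \<in> I" for S q
    using second_moment_cell_count[OF that(1) Q(1)[OF that(2)] Q(2)[OF that(2)]] unfolding dev_def by simp_all
  define f where "f X = (\<Sum>q\<in>I. dev {1..n} q X)" for X
  define g where "g X = (\<Sum>u\<in>{1..n}. \<Sum>q\<in>I. dev (Nb u) q X)" for X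
  have cI: "0 < real (card I)" using I by (simp add: card_gt_0_iff)
  have fi: "integrable ?M f" unfolding f_def using dev(1) by auto
  have gi: "integrable ?M g" unfolding g_def using dev(1) Nb by (intro Bochner_Integration.integrable_sum) auto
  have f0: "0 \<le> f X" "0 \<le> g X" for X by (auto simp: f_def g_def dev_def intro!: sum_nonneg)
  have "(\<integral>X. f X \<partial>?M) = (\<Sum>q\<in>I. \<integral>X. dev {1..n} q X \<partial>?M)"
    unfolding f_def using dev(1) by (intro Bochner_Integration.integral_sum) auto
  also have "\<dots> \<le> (\<Sum>q\<in>I. card {1..n} / card I)" using dev(2)[of "{1..n}"] by (intro sum_mono) blast
  finally have Ef: "(\<integral>X. f X \<partial>?M) \<le> n" using cI by simp
  have "(\<integral>X. g X \<partial>?M) = (\<Sum>u\<in>{1..n}. \<Sum>q\<in>I. \<integral>X. dev (Nb u) q X \<partial>?M)"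
    unfolding g_def using dev(1) Nb by (simp add: Bochner_Integration.integral_sum Bochner_Integration.integrable_sum)
  also have "\<dots> \<le> (\<Sum>u\<in>{1..n}. \<Sum>q\<in>I. n / card I)"
  proof (intro sum_mono)
    fix u q assume uq: "u \<in> {1..n}" "q \<in> I"
    have "(\<integral>X. dev (Nb u) q X \<partial>?M) \<le> card (Nb u) / card I" using dev(2) Nb uq by blast
    also have "\<dots> \<le> n / card I" using card_mono[OF _ Nb[OF uq(1)]] by (intro divide_right_mono) auto
    finally show "(\<integral>X. dev (Nb u) q X \<partial>?M) \<le> n / card I" .
  qed
  finally have Eg: "(\<integral>X. g X \<partial>?M) \<le> (real n)\<^sup>2" using cI by (simp add: power2_eq_square)
  have n0: "0 < real n" using n by simp
  define A1 where "A1 = {X \<in> space ?M. f X \<ge> K * n}"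
  define A2 where "A2 = {X \<in> space ?M. g X \<ge> K * (real n)\<^sup>2}"
  have [measurable]: "f \<in> borel_measurable ?M" "g \<in> borel_measurable ?M" using fi gi by auto
  have A: "A1 \<in> M.events" "A2 \<in> M.events" unfolding A1_def A2_def by measurable
  have "M.prob A1 \<le> (\<integral>X. f X \<partial>?M) / (K * n)" unfolding A1_def
    by (rule integral_Markov_inequality_measure[OF fi Ev]) (use f0 K n0 in auto)
  also have "\<dots> \<le> n / (K * n)" using Ef K n0 by (intro divide_right_mono) auto
  finally have P1: "M.prob A1 \<le> 1 / K" using n0 by simp
  have "M.prob A2 \<le> (\<integral>X. g X \<partial>?M) / (K * (real n)\<^sup>2)" unfolding A2_def
    by (rule integral_Markov_inequality_measure[OF gi Ev]) (use f0 K n0 in auto)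
  also have "\<dots> \<le> (real n)\<^sup>2 / (K * (real n)\<^sup>2)" using Eg K n0 by (intro divide_right_mono) auto
  finally have P2: "M.prob A2 \<le> 1 / K" using n0 by simp
  have "space ?M \<subseteq> E \<union> (A1 \<union> A2)"
  proof
    fix X assume X: "X \<in> space ?M"
    show "X \<in> E \<union> (A1 \<union> A2)"
    proof (rule ccontr)
      assume neg: "X \<notin> E \<union> (A1 \<union> A2)"
      then have "f X \<le> K * n" "g X \<le> K * (real n)\<^sup>2" using X by (auto simp: A1_def A2_def)
      then have "X \<in> E" using good[OF X] by (simp add: f_def g_def dev_def)
      then show False using neg by simp
    qed
  qed
  then have "M.prob (space ?M) \<le> M.prob (E \<union> (A1 \<union> A2))" using A Ev by (intro M.finite_measure_mono) auto
  also have "\<dots> \<le> M.prob E + M.prob (A1 \<union> A2)" using A Ev by (intro measure_subadditive) auto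
  also have "M.prob (A1 \<union> A2) \<le> M.prob A1 + M.prob A2" using A by (intro measure_subadditive) auto
  finally show ?thesis using P1 P2 by (simp add: M.prob_space)
qed

text \<open>The graph is determined by the set of close pairs, which takes finitely many values,
  each on a measurable event. So any property \<open>\<phi>\<close> of the graph gives a measurable
  event.\<close>

lemma sets_geometric_graph_event:
  "{X \<in> space (uniform_points n :: (nat \<Rightarrow> real ^ 'd) measure). \<phi> (geometric_graph n r X)} \<in> sets (uniform_points n)"
proof -
  let ?M = "uniform_points n :: (nat \<Rightarrow> real ^ 'd) measure"
  define W where "W = {1..n} \<times> {1..n}"
  define c where "c X = {z \<in> W. fst z \<noteq> snd z \<and> norm (X (fst z) - X (snd z)) \<le> r}" for X :: "nat \<Rightarrow> real ^ 'd"
  have g: "geometric_graph n r X = (\<lambda>z. {fst z, snd z}) ` c X" for X :: "nat \<Rightarrow> real ^ 'd"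
  proof
    show "geometric_graph n r X \<subseteq> (\<lambda>z. {fst z, snd z}) ` c X"
    proof
      fix e assume "e \<in> geometric_graph n r X"
      then obtain i j where "e = {i, j}" "(i, j) \<in> c X" by (auto simp: geometric_graph_def c_def W_def)
      then show "e \<in> (\<lambda>z. {fst z, snd z}) ` c X" using rev_image_eqI[of "(i, j)" "c X" e "\<lambda>z. {fst z, snd z}"] by simp
    qed
    show "(\<lambda>z. {fst z, snd z}) ` c X \<subseteq> geometric_graph n r X"
      unfolding geometric_graph_def c_def W_def by clarsimp blast
  qed
  have [measurable]: "(\<lambda>X. X i) \<in> borel_measurable ?M" if "i \<in> {1..n}" for i
    using that by (rule measurable_uniform_points_component)
  have cm: "{X \<in> space ?M. c X = D} \<in> sets ?M" if "D \<subseteq> W" for D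
  proof -
    have "{X \<in> space ?M. c X = D} =
      {X \<in> space ?M. \<forall>z\<in>W. (fst z \<noteq> snd z \<and> norm (X (fst z) - X (snd z)) \<le> r) \<longleftrightarrow> z \<in> D}"
      using that by (auto simp: c_def)
    also have "\<dots> \<in> sets ?M"
    proof (rule sets.sets_Collect_finite_All)
      fix z assume "z \<in> W"
      then have z[measurable]: "(\<lambda>X. X (fst z)) \<in> borel_measurable ?M" "(\<lambda>X. X (snd z)) \<in> borel_measurable ?M"
        by (auto simp: W_def intro!: measurable_uniform_points_component)
      show "{X \<in> space ?M. (fst z \<noteq> snd z \<and> norm (X (fst z) - X (snd z)) \<le> r) \<longleftrightarrow> z \<in> D} \<in> sets ?M"
        by measurable
    qed (simp add: W_def)
    finally show ?thesis .
  qed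
  have "{X \<in> space ?M. \<phi> (geometric_graph n r X)} =
    (\<Union>D\<in>{D \<in> Pow W. \<phi> ((\<lambda>z. {fst z, snd z}) ` D)}. {X \<in> space ?M. c X = D})"
    unfolding g by (auto simp: c_def)
  also have "\<dots> \<in> sets ?M" using cm by (intro sets.finite_UN) (auto simp: W_def)
  finally show ?thesis .
qed

section \<open>The threshold\<close>

lemma card_neighbours_eq_vert_degree:
  assumes "simple_graph V E"
  shows "card {w. {v, w} \<in> E} = vert_degree E v"
proof -
  have "bij_betw (\<lambda>w. {v, w}) {w. {v, w} \<in> E} {e \<in> E. v \<in> e}"
    unfolding bij_betw_def
  proof
    show "inj_on (\<lambda>w. {v, w}) {w. {v, w} \<in> E}" by (auto simp: inj_on_def doubleton_eq_iff)
    show "(\<lambda>w. {v, w}) ` {w. {v, w} \<in> E} = {e \<in> E. v \<in> e}"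
    proof (intro equalityI subsetI)
      fix e assume e: "e \<in> {e \<in> E. v \<in> e}"
      then have "card e = 2" using assms by (auto simp: simple_graph_def)
      then obtain x y where "e = {x, y}" by (auto simp: card_2_iff)
      then obtain w where "e = {v, w}" using e by (auto simp: insert_commute)
      then show "e \<in> (\<lambda>w. {v, w}) ` {w. {v, w} \<in> E}" using e by auto
    qed auto
  qed
  then show ?thesis unfolding vert_degree_def by (rule bij_betw_same_card)
qed

text \<open>Open boxes are disjoint; the points that they miss simply count as vertices outside the cells.\<close>

definition grid_cell :: "nat \<Rightarrow> ('d \<Rightarrow> nat) \<Rightarrow> (real ^ 'd) set" where
  "grid_cell M g = box (\<chi> i. g i / M) (\<chi> i. (real (g i) + 1) / M)"

lemma mem_grid_cell: "x \<in> grid_cell M g \<longleftrightarrow> (\<forall>i. g i / M < x $ i \<and> x $ i < (real (g i) + 1) / M)"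
  by (simp add: grid_cell_def mem_box_cart)

lemma grid_cell_disjoint:
  fixes g h :: "'d::finite \<Rightarrow> nat"
  assumes "0 < M" "g \<noteq> h"
  shows "grid_cell M g \<inter> grid_cell M h = {}"
proof -
  have sep: False if x: "x \<in> grid_cell M g" "x \<in> grid_cell M h" and "g i < h i" for x :: "real ^ 'd" and i and g h :: "'d \<Rightarrow> nat"
  proof -
    have "x $ i < (real (g i) + 1) / M" "h i / M < x $ i" using x by (auto simp: mem_grid_cell)
    then have "real (h i) / M < (real (g i) + 1) / M" by linarith
    then have "real (h i) < real (g i) + 1" using assms(1) by (simp add: divide_less_cancel)
    then show False using that(3) by linarith
  qed
  from assms(2) obtain i where "g i \<noteq> h i" by blast
  then consider "g i < h i" | "h i < g i" by linarith
  then show ?thesis using sep by cases blast+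
qed

lemma prob_grid_cell:
  fixes g :: "'d::finite \<Rightarrow> nat"
  assumes "\<And>i. g i < M"
  shows "measure unit_cube (grid_cell M g) = 1 / real M ^ CARD('d)"
proof -
  have M: "0 < M" using assms[of undefined] by simp
  let ?a = "\<chi> i. g i / M" and ?b = "\<chi> i. (real (g i) + 1) / M"
  have ab: "?a $ i \<le> ?b $ i" for i using M by (simp add: divide_right_mono)
  have sub: "grid_cell M g \<subseteq> cbox 0 1"
  proof
    fix x assume "x \<in> grid_cell M g"
    then have x: "g i / M < x $ i" "x $ i < (real (g i) + 1) / M" for i by (auto simp: mem_grid_cell)
    have "(real (g i) + 1) / M \<le> 1" for i using assms[of i] M by (simp add: divide_le_eq)
    then have "x $ i \<le> 1" for i using x(2)[of i] by (smt (verit))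
    moreover have "0 \<le> x $ i" for i using x(1)[of i] by (smt (verit) divide_nonneg_nonneg of_nat_0_le_iff)
    ultimately show "x \<in> cbox 0 1" by (auto simp: mem_box_cart)
  qed
  have "emeasure unit_cube (grid_cell M g) = emeasure lborel (cbox 0 1 \<inter> grid_cell M g)"
    by (rule emeasure_unit_cube_eq) (simp add: grid_cell_def)
  also have "\<dots> = emeasure lborel (box ?a ?b)" using sub by (simp add: Int_absorb1 grid_cell_def)
  also have "\<dots> = emeasure lborel (cbox ?a ?b)" by (simp add: emeasure_lborel_box_eq emeasure_lborel_cbox_eq)
  also have "\<dots> = ennreal (\<Prod>i\<in>UNIV. ?b $ i - ?a $ i)" by (rule emeasure_lborel_cbox_cart[OF ab])
  also have "(\<Prod>i\<in>UNIV. ?b $ i - ?a $ i) = 1 / real M ^ CARD('d)"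
    by (simp add: diff_divide_distrib[symmetric] power_one_over)
  finally show ?thesis by (simp add: measure_def)
qed

text \<open>The sum norm gives \<open>d / M\<close> in place of the exact diameter
  \<open>sqrt d / M\<close>; the loss is a constant factor, harmless for a threshold.\<close>

lemma norm_diff_grid_cell_le:
  fixes g :: "'d::finite \<Rightarrow> nat"
  assumes "x \<in> grid_cell M g" "y \<in> grid_cell M g"
  shows "norm (x - y) \<le> CARD('d) / M"
proof -
  have "norm (x - y) \<le> (\<Sum>i\<in>UNIV. \<bar>(x - y) $ i\<bar>)" by (rule norm_le_l1_cart)
  also have "\<dots> \<le> (\<Sum>i\<in>(UNIV :: 'd set). 1 / real M)"
  proof (rule sum_mono)
    fix i
    have "g i / M < x $ i" "x $ i < (real (g i) + 1) / M" "g i / M < y $ i" "y $ i < (real (g i) + 1) / M"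
      using assms by (auto simp: mem_grid_cell)
    then show "\<bar>(x - y) $ i\<bar> \<le> 1 / real M" by (simp add: add_divide_distrib abs_le_iff)
  qed
  finally show ?thesis by simp
qed

section \<open>The upper bound\<close>

text \<open>Joins the random and the deterministic half for one \<open>n\<close> and one grid. The
  conditions on \<open>m\<close> involve only \<open>\<alpha>\<close>, \<open>k\<close>,
  \<open>t\<close>, \<open>\<rho>\<close> and \<open>K\<close>, so a grid can be chosen without
  looking at \<open>H\<close>.\<close>

lemma perturbed_ham_cycle_power_prob_ge:
  fixes H :: "nat set set" and r \<alpha> K \<rho> :: real
  assumes n: "1 \<le> n" and H: "simple_graph {1..n} H" "\<alpha> * n \<le> min_degree {1..n} H"
    and M6: "6 \<le> M" and r: "CARD('d::finite) / M \<le> r" and m: "m = n / real M ^ CARD('d)"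
    and \<alpha>: "0 < \<alpha>" "\<alpha> < 1" and k: "1 \<le> k" and K: "0 < K"
    and \<rho>: "\<rho> = \<alpha> / (16 * (1 + 2 * real k))"
    and t: "8 * real k / \<alpha> \<le> real t"
    and m1: "4 * real t * 2 ^ t < m" and m2: "K \<le> \<rho> ^ 3 * m"
    and m3: "16 * K \<le> \<alpha>\<^sup>2 * \<rho>\<^sup>2 * m" and m4: "16 * real k \<le> \<alpha> * m"
  shows "1 - 2 / K \<le> \<P>(X in (uniform_points n :: (nat \<Rightarrow> real ^ 'd) measure).
           contains_ham_cycle_power k {1..n} (H \<union> geometric_graph n r X))"
proof -
  define I where "I = (PiE UNIV (\<lambda>_. {..<M}) :: ('d \<Rightarrow> nat) set)"
  have cI: "card I = M ^ CARD('d)" by (simp add: I_def card_PiE)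
  have finI: "finite I" unfolding I_def by (intro finite_PiE) auto
  have "M ^ 1 \<le> M ^ CARD('d)" using M6 by (intro power_increasing) (auto simp: Suc_le_eq)
  then have I6: "6 \<le> card I" using M6 cI by simp
  have gI: "g i < M" if "g \<in> I" for g i using that by (auto simp: I_def)
  define Nb where "Nb u = {w. {u, w} \<in> H}" for u
  have NbV: "Nb u \<subseteq> {1..n}" for u using H(1) by (auto simp: Nb_def simple_graph_def)
  have Nbdeg: "\<alpha> * n \<le> card (Nb u)" if "u \<in> {1..n}" for u
  proof -
    have "min_degree {1..n} H \<le> vert_degree H u" unfolding min_degree_def using that by (intro Min_le) auto
    then show ?thesis using H(2) card_neighbours_eq_vert_degree[OF H(1), of u] by (simp add: Nb_def)
  qed
  show ?thesis
  proof (rule prob_regular_cells[where I = I and Q = "grid_cell M" and Nb = Nb])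
    show "I \<noteq> {}" using I6 by auto
    show "grid_cell M q \<in> sets borel" for q :: "'d \<Rightarrow> nat" by (simp add: grid_cell_def)
    show "measure unit_cube (grid_cell M q) = 1 / card I" if "q \<in> I" for q :: "'d \<Rightarrow> nat"
      using prob_grid_cell[OF gI[OF that]] by (simp add: cI)
    show "{X \<in> space (uniform_points n :: (nat \<Rightarrow> real ^ 'd) measure). contains_ham_cycle_power k {1..n} (H \<union> geometric_graph n r X)}
        \<in> sets (uniform_points n)"
      by (rule sets_geometric_graph_event)
    fix X assume X: "X \<in> space (uniform_points n :: (nat \<Rightarrow> real ^ 'd) measure)"
      and d1: "(\<Sum>q\<in>I. (real (card {u \<in> {1..n}. X u \<in> grid_cell M q}) - n / card I)\<^sup>2) \<le> K * n"
      and d2: "(\<Sum>u\<in>{1..n}. \<Sum>q\<in>I. (real (card {v \<in> Nb u. X v \<in> grid_cell M q}) - card (Nb u) / card I)\<^sup>2) \<le> K * (real n)\<^sup>2"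
    define A where "A q = {u \<in> {1..n}. X u \<in> grid_cell M q}" for q
    have NA: "Nb u \<inter> A q = {v \<in> Nb u. X v \<in> grid_cell M q}" for u q using NbV[of u] by (auto simp: A_def)
    have "contains_ham_cycle_power k {1..n} (H \<union> geometric_graph n r X)"
    proof (rule ham_cycle_power_if_regular_cells[where I = I and A = A and Nb = Nb and m = m and \<rho> = \<rho> and K = K and \<alpha> = \<alpha> and t = t])
      show "A p \<inter> A q = {}" if "p \<noteq> q" for p q
        using grid_cell_disjoint[of M p q] M6 that by (auto simp: A_def)
      show "{a, b} \<in> H \<union> geometric_graph n r X" if "a \<in> A p" "b \<in> A p" "a \<noteq> b" for p a b
      proof -
        have "norm (X a - X b) \<le> r"
          using norm_diff_grid_cell_le[of "X a" M p "X b"] that r by (simp add: A_def)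
        moreover have "a \<in> {1..n}" "b \<in> {1..n}" using that by (auto simp: A_def)
        ultimately show ?thesis using that(3) unfolding geometric_graph_def by blast
      qed
      show "{u, v} \<in> H \<union> geometric_graph n r X" if "v \<in> Nb u" for u v using that by (simp add: Nb_def)
      show "\<alpha> * card {1..n} \<le> card (Nb u)" if "u \<in> {1..n}" for u using Nbdeg[OF that] by simp
      show "(\<Sum>q\<in>I. (card (A q) - m)\<^sup>2) \<le> K * card {1..n}"
        using d1 by (simp add: A_def m cI)
      show "(\<Sum>u\<in>{1..n}. \<Sum>q\<in>I. (card (Nb u \<inter> A q) - card (Nb u) / card I)\<^sup>2) \<le> K * (card {1..n})\<^sup>2"
        using d2 by (simp add: NA)
      show "m = card {1..n} / card I" by (simp add: m cI)
    qed (use finI I6 NbV assms in \<open>auto simp: A_def\<close>)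
    then show "X \<in> {X \<in> space (uniform_points n). contains_ham_cycle_power k {1..n} (H \<union> geometric_graph n r X)}"
      using X by simp
  qed (use n finI NbV K in auto)
qed

lemma perturbed_upper_threshold:
  fixes H :: "nat \<Rightarrow> nat set set" and r :: "nat \<Rightarrow> real" and \<alpha> :: real
  assumes k: "1 \<le> k" and \<alpha>: "0 < \<alpha>" "\<alpha> < 1"
    and H: "\<And>n. simple_graph {1..n} (H n)"
      "\<forall>\<^sub>F n in sequentially. real (min_degree {1..n} (H n)) \<ge> \<alpha> * real n"
    and r0: "\<And>n. r n \<ge> 0" and r: "r \<in> \<omega>(\<lambda>n. real n powr (- 1 / real CARD('d::finite)))"
  shows "(\<lambda>n. \<P>(X in (uniform_points n :: (nat \<Rightarrow> real ^ 'd) measure).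
           contains_ham_cycle_power k {1..n} (H n \<union> geometric_graph n (r n) X))) \<longlonglongrightarrow> 1"
    (is "?P \<longlonglongrightarrow> 1")
proof (rule tendstoI)
  fix e :: real assume e: "0 < e"
  define d where "d = CARD('d)"
  have d: "0 < d" by (simp add: d_def)
  \<comment> \<open>Makes the failure probability \<open>2 / K\<close> equal to
    \<open>e / 2\<close>.\<close>
  define K where "K = 4 / e"
  have K: "0 < K" using e by (simp add: K_def)
  define \<rho> where "\<rho> = \<alpha> / (16 * (1 + 2 * real k))"
  have \<rho>0: "0 < \<rho>" using \<alpha> by (simp add: \<rho>_def)
  define t where "t = nat \<lceil>8 * real k / \<alpha>\<rceil>"
  have t: "8 * real k / \<alpha> \<le> real t" unfolding t_def by (rule real_nat_ceiling_ge)
  \<comment> \<open>The sum of the four lower bounds required of \<open>m\<close>, plus 1 to make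
    the first of them strict.\<close>
  define m0 where "m0 = 4 * real t * 2 ^ t + K / \<rho> ^ 3 + 16 * K / (\<alpha>\<^sup>2 * \<rho>\<^sup>2) + 16 * real k / \<alpha> + 1"
  have parts: "0 \<le> 4 * real t * 2 ^ t" "0 \<le> K / \<rho> ^ 3" "0 \<le> 16 * K / (\<alpha>\<^sup>2 * \<rho>\<^sup>2)" "0 \<le> 16 * real k / \<alpha>"
    using K \<rho>0 \<alpha> by auto
  have m0: "0 < m0" using parts unfolding m0_def by linarith
  \<comment> \<open>With \<open>M \<ge> y / 2\<close> below, the diameter bound \<open>d / M\<close>
    is at most \<open>2 * d / y\<close>, which is \<open>c\<close> times \<open>n\<close> to the
    power \<open>-1/d\<close>; the assumption on \<open>r\<close> dominates any such constant
    eventually.\<close>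
  define c where "c = 2 * real d * m0 powr (1 / d)"
  have c: "0 < c" using d m0 by (simp add: c_def)
  \<comment> \<open>Ensures \<open>y \<ge> 7\<close>, so that rounding down still leaves
    \<open>M \<ge> 6\<close>.\<close>
  have big: "\<forall>\<^sub>F n in sequentially. real n \<ge> m0 * 7 ^ d"
    using filterlim_real_sequentially by (simp add: filterlim_at_top)
  have rr: "\<forall>\<^sub>F n in sequentially. c * norm (real n powr (- 1 / real d)) \<le> norm (r n)"
    using landau_omega.smallD[OF r c] by (simp add: d_def)
  show "\<forall>\<^sub>F n in sequentially. dist (?P n) 1 < e"
    using H(2) big rr eventually_ge_at_top[of 1]
  proof eventually_elim
    case (elim n)
    \<comment> \<open>The real grid size for which cells would have average size exactly
      \<open>m0\<close>; rounding it down can only enlarge them.\<close>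
    define y where "y = (n / m0) powr (1 / d)"
    define M where "M = nat \<lfloor>y\<rfloor>"
    have n0: "0 < real n" using elim(4) by simp
    have yd: "y ^ d = n / m0"
      using n0 m0 d by (simp add: y_def powr_realpow[symmetric] powr_powr)
    have y0: "0 \<le> y" by (simp add: y_def)
    have y7: "7 \<le> y"
    proof (rule power_le_imp_le_base)
      have "7 ^ d \<le> n / m0" using elim(2) m0 by (simp add: pos_le_divide_eq mult.commute)
      then show "7 ^ Suc (d - 1) \<le> y ^ Suc (d - 1)" using d yd by simp
    qed (rule y0)
    have My: "real M \<le> y" "y - 1 \<le> real M" using y0 by (auto simp: M_def)
    have M6: "6 \<le> M" using My y7 by linarith
    have Md: "real M ^ d \<le> n / m0" using power_mono[OF My(1), of d] yd by simp
    have Mpos: "0 < real M ^ d" using M6 by simp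
    define m where "m = n / real M ^ d"
    have mm: "m0 \<le> m" using Md m0 Mpos by (simp add: m_def field_simps)
    have rM: "d / M \<le> r n"
    proof -
      have "d / M \<le> d / (y / 2)" using My y7 d by (intro divide_left_mono) auto
      also have "\<dots> = 2 * d * (1 / y)" by simp
      also have "1 / y = m0 powr (1 / d) * real n powr (- 1 / d)"
        using n0 m0 by (simp add: y_def powr_divide powr_minus_divide minus_divide_left[symmetric])
      also have "2 * d * (m0 powr (1 / d) * real n powr (- 1 / d)) = c * real n powr (- 1 / d)" by (simp add: c_def)
      also have "\<dots> \<le> r n" using elim(3) r0[of n] by simp
      finally show ?thesis .
    qed
    have "1 - 2 / K \<le> ?P n"
    proof (rule perturbed_ham_cycle_power_prob_ge[where M = M and m = m and \<alpha> = \<alpha> and \<rho> = \<rho> and t = t])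
      show "4 * real t * 2 ^ t < m" using mm parts unfolding m0_def by linarith
      have "K / \<rho> ^ 3 \<le> m" using mm parts unfolding m0_def by linarith
      then show "K \<le> \<rho> ^ 3 * m" using \<rho>0 by (simp add: field_simps)
      have "16 * K / (\<alpha>\<^sup>2 * \<rho>\<^sup>2) \<le> m" using mm parts unfolding m0_def by linarith
      then show "16 * K \<le> \<alpha>\<^sup>2 * \<rho>\<^sup>2 * m" using \<rho>0 \<alpha> by (simp add: field_simps)
      have "16 * real k / \<alpha> \<le> m" using mm parts unfolding m0_def by linarith
      then show "16 * real k \<le> \<alpha> * m" using \<alpha> by (simp add: field_simps)
    qed (use elim H(1) M6 rM \<alpha> k K t in \<open>auto simp: m_def d_def \<rho>_def\<close>)
    moreover have "?P n \<le> 1" by (rule prob_space.prob_le_1[OF prob_space_uniform_points])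
    moreover have "2 / K = e / 2" by (simp add: K_def)
    ultimately show ?case using e by (simp add: dist_real_def)
  qed
qed

section \<open>The lower bound\<close>

text \<open>Edges are unordered, so \<open>a < j\<close> merely asks that some endpoint exceed
  \<open>a\<close>; the independent set is \<open>{1..a}\<close>.\<close>

definition complete_minus_clique :: "nat \<Rightarrow> nat \<Rightarrow> nat set set" where
  "complete_minus_clique n a = {{i, j} | i j. i \<in> {1..n} \<and> j \<in> {1..n} \<and> i \<noteq> j \<and> a < j}"

lemma complete_minus_clique_simple: "simple_graph {1..n} (complete_minus_clique n a)"
  unfolding simple_graph_def complete_minus_clique_def by auto

text \<open>Vertices up to \<open>a\<close> have degree \<open>n - a\<close>, the others
  \<open>n - 1\<close>; the latter is at least \<open>n - a\<close> because
  \<open>1 \<le> a\<close>.\<close>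

lemma complete_minus_clique_min_degree:
  assumes "1 \<le> a" "1 \<le> n"
  shows "n - a \<le> min_degree {1..n} (complete_minus_clique n a)"
proof -
  let ?H = "complete_minus_clique n a"
  have deg: "n - a \<le> vert_degree ?H v" if v: "v \<in> {1..n}" for v
  proof -
    let ?N = "{w. {v, w} \<in> ?H}"
    have NV: "?N \<subseteq> {1..n}" using complete_minus_clique_simple[of n a] by (auto simp: simple_graph_def)
    have sub: "(if v \<le> a then {a<..n} else {1..n} - {v}) \<subseteq> ?N"
    proof
      fix w assume w: "w \<in> (if v \<le> a then {a<..n} else {1..n} - {v})"
      then have vw: "w \<in> {1..n}" "v \<noteq> w" "a < w \<or> a < v" by (auto split: if_splits)
      from vw(3) show "w \<in> ?N"
      proof
        assume "a < w"
        then show ?thesis using v vw unfolding complete_minus_clique_def by blast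
      next
        assume "a < v"
        then have "{w, v} \<in> ?H" using v vw unfolding complete_minus_clique_def by blast
        then show ?thesis by (simp add: insert_commute)
      qed
    qed
    have "n - a \<le> card (if v \<le> a then {a<..n} else {1..n} - {v})"
      using v assms by auto
    also have "\<dots> \<le> card ?N" using sub NV by (intro card_mono) (auto intro: finite_subset)
    finally show ?thesis using card_neighbours_eq_vert_degree[OF complete_minus_clique_simple] by simp
  qed
  show ?thesis unfolding min_degree_def using deg assms(2) by (subst Min_ge_iff) auto
qed

text \<open>Deleting one endpoint of every close pair from \<open>{1..a}\<close> leaves a set
  independent in the union, to which the bound on independent sets applies.\<close>

lemma ham_cycle_power_forces_close_pairs:
  fixes X :: "nat \<Rightarrow> real ^ 'd::finite"
  assumes "contains_ham_cycle_power k {1..n} (complete_minus_clique n a \<union> geometric_graph n r X)"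
    and "k < n" "a \<le> n"
  shows "(k + 1) * a \<le> n + (k + 1) * card {(i, j) \<in> {1..n} \<times> {1..n}. i < j \<and> norm (X i - X j) \<le> r}"
proof -
  let ?P = "{(i, j) \<in> {1..n} \<times> {1..n}. i < j \<and> norm (X i - X j) \<le> r}"
  \<comment> \<open>\<open>fst\<close> picks the smaller endpoint, so each close pair costs at most
    one vertex.\<close>
  define A where "A = {1..a} - fst ` ?P"
  have finP: "finite ?P" by (rule finite_subset[of _ "{1..n} \<times> {1..n}"]) auto
  have "(k + 1) * card A \<le> card {1..n}"
  proof (rule card_independent_le_if_ham_cycle_power[OF assms(1)])
    show "A \<subseteq> {1..n}" using assms(3) by (auto simp: A_def)
    show "k < card {1..n}" using assms(2) by simp
    fix x y assume xy: "x \<in> A" "y \<in> A"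
    show "{x, y} \<notin> complete_minus_clique n a \<union> geometric_graph n r X"
    proof
      assume "{x, y} \<in> complete_minus_clique n a \<union> geometric_graph n r X"
      moreover have "{x, y} \<notin> complete_minus_clique n a"
        using xy by (auto simp: complete_minus_clique_def A_def doubleton_eq_iff)
      ultimately have "x \<noteq> y" "norm (X x - X y) \<le> r"
        by (auto simp: geometric_graph_def doubleton_eq_iff norm_minus_commute)
      moreover have "x \<in> {1..n}" "y \<in> {1..n}" using xy assms(3) by (auto simp: A_def)
      ultimately have "(x, y) \<in> ?P \<or> (y, x) \<in> ?P" by (auto simp: norm_minus_commute)
      then show False using xy by (auto simp: A_def image_iff)
    qed
  qed
  moreover have "a \<le> card A + card ?P"
  proof -
    have "card {1..a} - card (fst ` ?P) \<le> card A" unfolding A_def using finP by (intro diff_card_le_card_Diff) auto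
    moreover have "card (fst ` ?P) \<le> card ?P" by (rule card_image_le[OF finP])
    ultimately show ?thesis by simp
  qed
  then have "(k + 1) * a \<le> (k + 1) * (card A + card ?P)" by (rule mult_le_mono2)
  ultimately show ?thesis by (simp add: algebra_simps)
qed

text \<open>A first-moment bound: at most \<open>n\<^sup>2\<close> pairs, each close with
  probability at most \<open>(2 * r) ^ d\<close>, followed by Markov's inequality.\<close>

lemma prob_many_close_pairs_le:
  fixes r s :: real
  assumes r: "0 \<le> r" and s: "0 < s"
  shows "\<P>(X in (uniform_points n :: (nat \<Rightarrow> real ^ 'd) measure).
      s \<le> card {(i, j) \<in> {1..n} \<times> {1..n}. i < j \<and> norm (X i - X j) \<le> r}) \<le> (real n)\<^sup>2 * (2 * r) ^ CARD('d) / s"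
    and "{X \<in> space (uniform_points n :: (nat \<Rightarrow> real ^ 'd) measure).
      s \<le> card {(i, j) \<in> {1..n} \<times> {1..n}. i < j \<and> norm (X i - X j) \<le> r}} \<in> sets (uniform_points n)"
proof -
  let ?M = "uniform_points n :: (nat \<Rightarrow> real ^ 'd) measure"
  interpret M: prob_space ?M by (rule prob_space_uniform_points)
  define W where "W = {(i, j) \<in> {1..n} \<times> {1..n}. i < j}"
  define B where "B z = {X \<in> space ?M. norm (X (fst z) - X (snd z)) \<le> r}" for z
  have finW: "finite W" unfolding W_def by (rule finite_subset[of _ "{1..n} \<times> {1..n}"]) auto
  have cW: "card W \<le> n * n"
  proof -
    have "W \<subseteq> {1..n} \<times> {1..n}" by (auto simp: W_def)
    then have "card W \<le> card ({1..n} \<times> {1..n})" by (intro card_mono) auto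
    then show ?thesis by (simp add: card_cartesian_product)
  qed
  have Bm: "B z \<in> M.events" if "z \<in> W" for z
  proof -
    have [measurable]: "(\<lambda>X. X (fst z)) \<in> borel_measurable ?M" "(\<lambda>X. X (snd z)) \<in> borel_measurable ?M"
      using that by (auto simp: W_def intro!: measurable_uniform_points_component)
    show ?thesis unfolding B_def by measurable
  qed
  define f where "f X = (\<Sum>z\<in>W. indicat_real (B z) X)" for X
  have fi: "integrable ?M f"
    unfolding f_def using Bm by (intro Bochner_Integration.integrable_sum) (simp add: integrable_indicator_iff less_top[symmetric])
  have f_eq: "real (card {(i, j) \<in> {1..n} \<times> {1..n}. i < j \<and> norm (X i - X j) \<le> r}) = f X" if "X \<in> space ?M" for X
  proof -
    have "f X = (\<Sum>z\<in>W. if norm (X (fst z) - X (snd z)) \<le> r then 1 else 0)"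
      unfolding f_def using that by (intro sum.cong) (auto simp: B_def)
    also have "\<dots> = real (card {z \<in> W. norm (X (fst z) - X (snd z)) \<le> r})"
      using finW by (simp add: sum.If_cases Int_def)
    also have "{z \<in> W. norm (X (fst z) - X (snd z)) \<le> r} = {(i, j) \<in> {1..n} \<times> {1..n}. i < j \<and> norm (X i - X j) \<le> r}"
      by (auto simp: W_def)
    finally show ?thesis by simp
  qed
  have eq: "{X \<in> space ?M. s \<le> card {(i, j) \<in> {1..n} \<times> {1..n}. i < j \<and> norm (X i - X j) \<le> r}} = {X \<in> space ?M. s \<le> f X}"
    using f_eq by auto
  have [measurable]: "f \<in> borel_measurable ?M" using fi by auto
  have "{X \<in> space ?M. s \<le> f X} \<in> M.events" by measurable
  then show "{X \<in> space ?M. s \<le> card {(i, j) \<in> {1..n} \<times> {1..n}. i < j \<and> norm (X i - X j) \<le> r}} \<in> M.events"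
    unfolding eq .
  have "M.expectation f = (\<Sum>z\<in>W. M.expectation (indicat_real (B z)))"
    unfolding f_def using Bm by (intro Bochner_Integration.integral_sum) (simp add: integrable_indicator_iff less_top[symmetric])
  also have "\<dots> = (\<Sum>z\<in>W. M.prob (B z))" by (intro sum.cong) (auto simp: B_def Int_def intro!: arg_cong[where f = M.prob])
  also have "\<dots> \<le> (\<Sum>z\<in>W. (2 * r) ^ CARD('d))"
    unfolding B_def by (intro sum_mono prob_close_le) (auto simp: W_def r)
  also have "\<dots> = card W * (2 * r) ^ CARD('d)" by simp
  also have "\<dots> \<le> (real n)\<^sup>2 * (2 * r) ^ CARD('d)"
  proof (rule mult_right_mono)
    show "real (card W) \<le> (real n)\<^sup>2" using cW by (metis of_nat_le_iff of_nat_mult power2_eq_square)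
  qed (use r in simp)
  finally have Ef: "M.expectation f \<le> (real n)\<^sup>2 * (2 * r) ^ CARD('d)" .
  have "M.prob {X \<in> space ?M. s \<le> f X} \<le> M.expectation f / s"
    by (rule integral_Markov_inequality_measure[OF fi sets.top]) (auto simp: f_def s intro!: sum_nonneg)
  also have "\<dots> \<le> (real n)\<^sup>2 * (2 * r) ^ CARD('d) / s" using Ef s by (intro divide_right_mono) auto
  finally show "M.prob {X \<in> space ?M. s \<le> card {(i, j) \<in> {1..n} \<times> {1..n}. i < j \<and> norm (X i - X j) \<le> r}}
    \<le> (real n)\<^sup>2 * (2 * r) ^ CARD('d) / s" unfolding eq .
qed

text \<open>Rounding \<open>(1 - \<alpha>) * n\<close> down keeps the degree \<open>n - a n\<close>
  at least \<open>\<alpha> * n\<close> and shrinks the independent set by at most one vertex. The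
  surplus density \<open>(1 - \<alpha>) - 1 / (k + 1)\<close> is positive exactly when
  \<open>\<alpha> < k / (k + 1)\<close>.\<close>

lemma perturbed_lower_threshold:
  fixes \<alpha> :: real and k :: nat
  assumes k: "1 \<le> k" and \<alpha>: "0 < \<alpha>" "\<alpha> < real k / (real k + 1)"
  defines "a \<equiv> \<lambda>n. nat \<lfloor>(1 - \<alpha>) * real n\<rfloor>"
  shows "\<forall>\<^sub>F n in sequentially. real (min_degree {1..n} (complete_minus_clique n (a n))) \<ge> \<alpha> * real n"
    and "\<And>r. (\<And>n. 0 \<le> r n) \<Longrightarrow> r \<in> o(\<lambda>n. real n powr (- 1 / real CARD('d::finite))) \<Longrightarrow>
      (\<lambda>n. \<P>(X in (uniform_points n :: (nat \<Rightarrow> real ^ 'd) measure).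
         contains_ham_cycle_power k {1..n} (complete_minus_clique n (a n) \<union> geometric_graph n (r n) X))) \<longlonglongrightarrow> 0"
proof -
  have "real k / (real k + 1) < 1" by simp
  then have \<alpha>1: "\<alpha> < 1" using \<alpha> by linarith
  have a_le: "real (a n) \<le> (1 - \<alpha>) * n" and a_ge: "(1 - \<alpha>) * n - 1 \<le> real (a n)" for n
    using \<alpha>1 by (auto simp: a_def)
  have ann: "a n \<le> n" for n
  proof -
    have "(1 - \<alpha>) * n \<le> 1 * real n" using \<alpha> by (intro mult_right_mono) auto
    then show ?thesis using a_le[of n] by linarith
  qed
  have ev: "\<forall>\<^sub>F n in sequentially. real n \<ge> C" for C :: real
    using filterlim_real_sequentially by (simp add: filterlim_at_top)
  show "\<forall>\<^sub>F n in sequentially. real (min_degree {1..n} (complete_minus_clique n (a n))) \<ge> \<alpha> * real n"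
    using ev[of "2 / (1 - \<alpha>)"] eventually_ge_at_top[of 1]
  proof eventually_elim
    case (elim n)
    have "2 \<le> (1 - \<alpha>) * n" using elim(1) \<alpha>1 by (simp add: field_simps)
    then have "1 \<le> a n" using a_ge[of n] by linarith
    then have "n - a n \<le> min_degree {1..n} (complete_minus_clique n (a n))"
      using elim(2) by (rule complete_minus_clique_min_degree)
    then have "real n - real (a n) \<le> min_degree {1..n} (complete_minus_clique n (a n))"
      using ann[of n] by linarith
    then show ?case using a_le[of n] by (simp add: algebra_simps)
  qed
  fix r :: "nat \<Rightarrow> real"
  assume r0: "\<And>n. 0 \<le> r n" and r: "r \<in> o(\<lambda>n. real n powr (- 1 / real CARD('d)))"
  define d where "d = CARD('d)"
  have d: "0 < d" by (simp add: d_def)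
  \<comment> \<open>Half of the surplus density: of the \<open>2 * c * n\<close> surplus vertices,
    \<open>c * n\<close> are spared to pay for the rounding of \<open>a n\<close>, which is why
    \<open>n \<ge> 1 / c\<close> is imposed.\<close>
  define c where "c = (real k / (real k + 1) - \<alpha>) / 2"
  have c: "0 < c" using \<alpha> by (simp add: c_def)
  let ?P = "\<lambda>n. \<P>(X in (uniform_points n :: (nat \<Rightarrow> real ^ 'd) measure).
         contains_ham_cycle_power k {1..n} (complete_minus_clique n (a n) \<union> geometric_graph n (r n) X))"
  let ?g = "\<lambda>n. (2 * (r n / real n powr (- 1 / real d))) ^ d / c"
  have "(\<lambda>n. r n / real n powr (- 1 / real d)) \<longlonglongrightarrow> 0"
    using smalloD_tendsto[OF r] by (simp add: d_def)
  then have "?g \<longlonglongrightarrow> (2 * 0) ^ d / c" by (intro tendsto_intros) (use c in auto)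
  then have lim: "?g \<longlonglongrightarrow> 0" using d by (simp add: power_0_left)
  have upper: "\<forall>\<^sub>F n in sequentially. ?P n \<le> ?g n"
    using ev[of "1 / c"] ev[of "real k + 1"] eventually_ge_at_top[of 1]
  proof eventually_elim
    case (elim n)
    let ?M = "uniform_points n :: (nat \<Rightarrow> real ^ 'd) measure"
    interpret M: prob_space ?M by (rule prob_space_uniform_points)
    have n0: "0 < real n" using elim(3) by simp
    let ?B = "{X \<in> space ?M. c * n \<le> card {(i, j) \<in> {1..n} \<times> {1..n}. i < j \<and> norm (X i - X j) \<le> r n}}"
    have cn: "0 < c * n" using c n0 by simp
    have "?P n \<le> M.prob ?B"
    proof (rule M.finite_measure_mono)
      show "?B \<in> M.events" by (rule prob_many_close_pairs_le(2)[OF r0 cn])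
      show "{X \<in> space ?M. contains_ham_cycle_power k {1..n} (complete_minus_clique n (a n) \<union> geometric_graph n (r n) X)} \<subseteq> ?B"
      proof safe
        fix X :: "nat \<Rightarrow> real ^ 'd"
        assume "contains_ham_cycle_power k {1..n} (complete_minus_clique n (a n) \<union> geometric_graph n (r n) X)"
        moreover have "k < n" using elim(2) by linarith
        ultimately have "(k + 1) * a n \<le> n + (k + 1) * card {(i, j) \<in> {1..n} \<times> {1..n}. i < j \<and> norm (X i - X j) \<le> r n}"
          (is "_ \<le> n + (k + 1) * ?p")
          using ann by (rule ham_cycle_power_forces_close_pairs)
        then have "real ((k + 1) * a n) \<le> real (n + (k + 1) * ?p)" by (rule of_nat_mono)
        then have "(real k + 1) * a n \<le> n + (real k + 1) * ?p" by (simp only: of_nat_mult of_nat_add of_nat_1)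
        then have "a n \<le> n / (real k + 1) + ?p" by (simp add: field_simps)
        moreover have "1 \<le> c * n" using elim(1) c by (simp add: field_simps)
        moreover have "(1 - \<alpha>) * n - n / (real k + 1) = 2 * (c * n)"
        proof -
          have "1 - 1 / (real k + 1) = real k / (real k + 1)" by (simp add: field_simps)
          then have "(1 - \<alpha>) - 1 / (real k + 1) = 2 * c" by (simp add: c_def)
          then have "((1 - \<alpha>) - 1 / (real k + 1)) * n = 2 * c * n" by simp
          then show ?thesis by (simp add: algebra_simps)
        qed
        ultimately show "c * n \<le> real ?p" using a_ge[of n] by linarith
      qed
    qed
    also have "\<dots> \<le> (real n)\<^sup>2 * (2 * r n) ^ CARD('d) / (c * n)" by (rule prob_many_close_pairs_le(1)[OF r0 cn])
    \<comment> \<open>The expected number of close pairs divided by \<open>c * n\<close> leaves one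
      factor \<open>n\<close>, and \<open>n\<close> is the \<open>d\<close>-th power of the
      reciprocal of the threshold; hence \<open>?g\<close>, which depends only on the ratio of
      \<open>r n\<close> to it.\<close>
    also have "\<dots> = real n * (2 * r n) ^ d / c" using n0 by (simp add: power2_eq_square d_def)
    also have "\<dots> = ?g n"
    proof -
      have "(real n powr (- 1 / real d)) ^ d = real n powr (real d * (- 1 / real d))"
        using n0 by (intro powr_power) simp
      also have "real d * (- 1 / real d) = - 1" using d by simp
      also have "real n powr (- 1) = 1 / n" using n0 by (simp add: powr_minus_divide)
      finally have "(real n powr (- 1 / real d)) ^ d = 1 / n" .
      then show ?thesis by (simp add: power_mult_distrib power_divide)
    qed
    finally show ?case .
  qed
  show "?P \<longlonglongrightarrow> 0"
    by (rule tendsto_sandwich[OF _ upper tendsto_const lim]) simp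
qed

theorem theorem1p2:
  fixes k :: nat and \<alpha> :: real
  assumes "k \<ge> 1" and "0 < \<alpha>" and "\<alpha> < real k / (real k + 1)"
  shows
    "(\<forall>H :: nat \<Rightarrow> nat set set.
        (\<forall>n. simple_graph {1..n} (H n)) \<longrightarrow>
        (\<forall>\<^sub>F n in sequentially. real (min_degree {1..n} (H n)) \<ge> \<alpha> * real n) \<longrightarrow>
        (\<forall>r :: nat \<Rightarrow> real.
           (\<forall>n. r n \<ge> 0) \<longrightarrow>
           r \<in> \<omega>(\<lambda>n. real n powr (- 1 / real CARD('d::finite))) \<longrightarrow>
           (\<lambda>n. \<P>(X in (uniform_points n :: (nat \<Rightarrow> real ^ 'd) measure).
                  contains_ham_cycle_power k {1..n} (H n \<union> geometric_graph n (r n) X)))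
             \<longlonglongrightarrow> 1)) \<and>
     (\<exists>H :: nat \<Rightarrow> nat set set.
        (\<forall>n. simple_graph {1..n} (H n)) \<and>
        (\<forall>\<^sub>F n in sequentially. real (min_degree {1..n} (H n)) \<ge> \<alpha> * real n) \<and>
        (\<forall>r :: nat \<Rightarrow> real.
           (\<forall>n. r n \<ge> 0) \<longrightarrow>
           r \<in> o(\<lambda>n. real n powr (- 1 / real CARD('d))) \<longrightarrow>
           (\<lambda>n. \<P>(X in (uniform_points n :: (nat \<Rightarrow> real ^ 'd) measure).
                  contains_ham_cycle_power k {1..n} (H n \<union> geometric_graph n (r n) X)))
             \<longlonglongrightarrow> 0))"
proof (rule conjI)
  have "real k / (real k + 1) < 1" by simp
  then have "\<alpha> < 1" using assms by linarith
  then show "\<forall>H :: nat \<Rightarrow> nat set set.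
        (\<forall>n. simple_graph {1..n} (H n)) \<longrightarrow>
        (\<forall>\<^sub>F n in sequentially. real (min_degree {1..n} (H n)) \<ge> \<alpha> * real n) \<longrightarrow>
        (\<forall>r :: nat \<Rightarrow> real.
           (\<forall>n. r n \<ge> 0) \<longrightarrow>
           r \<in> \<omega>(\<lambda>n. real n powr (- 1 / real CARD('d))) \<longrightarrow>
           (\<lambda>n. \<P>(X in (uniform_points n :: (nat \<Rightarrow> real ^ 'd) measure).
                  contains_ham_cycle_power k {1..n} (H n \<union> geometric_graph n (r n) X)))
             \<longlonglongrightarrow> 1)"
    using perturbed_upper_threshold[OF assms(1,2)] by blast
  show "\<exists>H :: nat \<Rightarrow> nat set set.
        (\<forall>n. simple_graph {1..n} (H n)) \<and>
        (\<forall>\<^sub>F n in sequentially. real (min_degree {1..n} (H n)) \<ge> \<alpha> * real n) \<and>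
        (\<forall>r :: nat \<Rightarrow> real.
           (\<forall>n. r n \<ge> 0) \<longrightarrow>
           r \<in> o(\<lambda>n. real n powr (- 1 / real CARD('d))) \<longrightarrow>
           (\<lambda>n. \<P>(X in (uniform_points n :: (nat \<Rightarrow> real ^ 'd) measure).
                  contains_ham_cycle_power k {1..n} (H n \<union> geometric_graph n (r n) X)))
             \<longlonglongrightarrow> 0)"
    using complete_minus_clique_simple perturbed_lower_threshold[OF assms]
    by (intro exI[of _ "\<lambda>n. complete_minus_clique n (nat \<lfloor>(1 - \<alpha>) * real n\<rfloor>)"]) blast
qed

end
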